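(* Let $T\colon[0,1]\setminus\mathbb{Q}\to[0,1]\setminus\mathbb{Q}$, $T(x)=\frac1x-\lfloor\frac1x\rfloor$, be the continued fraction map. If $\mu$ is a $T$-invariant Borel probability measure on $[0,1]\setminus\mathbb{Q}$, then the set of points in $[0,1]\setminus\mathbb{Q}$ that generate $\mu$ is a $\mathbf{\Pi}^0_3$-complete set, and the set of points in $[0,1]\setminus\mathbb{Q}$ with irregular continued fraction expansion is $\mathbf{\Sigma}^0_3$-complete.
   Context: $\mu$ is $T$-invariant if $\mu(B)=\mu(T^{-1}(B))$ for all Borel $B\subseteq[0,1]\setminus\mathbb{Q}$; $\mu$ is regarded as a measure on $[0,1]$ giving mass $0$ to the rationals. A point $x$ generates $\mu$ if for every interval $I\subseteq[0,1]$ with $\mu(\partial I)=0$ one has $\lim_{N\to\infty}\frac1N|\{0\le n<N: T^n(x)\in I\}|=\mu(I)$. The regular continued fraction expansion of $x\in[0,1]\setminus\mathbb{Q}$ is $d_1d_2\ldots\in\mathbb{N}^{\mathbb{N}}$ with $d_i=\lfloor 1/T^{i-1}(x)\rfloor$, where $\mathbb{N}=\{1,2,\ldots\}$. The expansion is irregular if there is a nonempty finite block $w=w_1\ldots w_k$ of positive integers for which $\frac1N|\{1\le i\le N: d_i\ldots d_{i+k-1}=w\}|$ does not converge as $N\to\infty$. In the Polish space $[0,1]\setminus\mathbb{Q}$: $\mathbf{\Sigma}^0_1$ = open sets, $\mathbf{\Pi}^0_k$ = complements of $\mathbf{\Sigma}^0_k$ sets, $\mathbf{\Sigma}^0_{k+1}$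 = countable unions of $\mathbf{\Pi}^0_k$ sets. A set is $\mathbf{\Pi}^0_3$-complete if it is in $\mathbf{\Pi}^0_3\setminus\mathbf{\Sigma}^0_3$, and $\mathbf{\Sigma}^0_3$-complete if it is in $\mathbf{\Sigma}^0_3\setminus\mathbf{\Pi}^0_3$. *)

theory Defs
  imports "HOL-Analysis.Analysis" "HOL-Probability.Probability_Measure"
begin

text \<open>
  The levels are indexed from 1, as usual; level 0 is a dummy value. Complements are relative to
  the underlying set of the space, so every member of a level is a subset of it.
\<close>

fun Sigma0 :: "'a topology \<Rightarrow> nat \<Rightarrow> 'a set set" where
  "Sigma0 X 0 = {}"
| "Sigma0 X (Suc 0) = {U. openin X U}"
| "Sigma0 X (Suc (Suc k)) =
     {\<Union>(range A) | A :: nat \<Rightarrow> 'a set.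
        range A \<subseteq> (\<lambda>B. topspace X - B) ` Sigma0 X (Suc k)}"

definition Pi0 :: "'a topology \<Rightarrow> nat \<Rightarrow> 'a set set" where
  "Pi0 X k = (\<lambda>B. topspace X - B) ` Sigma0 X k"

definition Sigma0_complete :: "'a topology \<Rightarrow> nat \<Rightarrow> 'a set \<Rightarrow> bool" where
  "Sigma0_complete X k A \<longleftrightarrow> A \<in> Sigma0 X k - Pi0 X k"

definition Pi0_complete :: "'a topology \<Rightarrow> nat \<Rightarrow> 'a set \<Rightarrow> bool" where
  "Pi0_complete X k A \<longleftrightarrow> A \<in> Pi0 X k - Sigma0 X k"

lemma Sigma0_Suc_Suc:
  "Sigma0 X (Suc (Suc k)) = {\<Union>(range A) | A :: nat \<Rightarrow> 'a set. range A \<subseteq> Pi0 X (Suc k)}"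
  by (simp add: Pi0_def)

definition unit_irrationals :: "real set" where
  "unit_irrationals = {0..1} - \<rat>"

definition cf_map :: "real \<Rightarrow> real" where
  "cf_map x = 1 / x - of_int \<lfloor>1 / x\<rfloor>"

lemma cf_map_in_unit_irrationals:
  assumes "x \<in> unit_irrationals"
  shows "cf_map x \<in> unit_irrationals"
proof -
  have "1 / x \<notin> \<rat>"
    using assms Rats_inverse[of "1 / x"] by (auto simp: unit_irrationals_def inverse_eq_divide)
  hence "cf_map x \<notin> \<rat>"
    using Rats_add[of "cf_map x" "of_int \<lfloor>1 / x\<rfloor>"] by (auto simp: cf_map_def)
  moreover have "0 \<le> cf_map x" "cf_map x \<le> 1"
    unfolding cf_map_def by linarith+
  ultimately show ?thesis
    by (simp add: unit_irrationals_def)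
qed

text \<open>
  A Borel measure \<open>M\<close> on \<open>unit_irrationals\<close> is a measure with
  \<open>sets M = sets (restrict_space borel unit_irrationals)\<close>, so that
  \<open>space M = unit_irrationals\<close>.
\<close>

definition cf_invariant :: "real measure \<Rightarrow> bool" where
  "cf_invariant M \<longleftrightarrow> (\<forall>B\<in>sets M. emeasure M B = emeasure M (cf_map -` B \<inter> space M))"

text \<open>
  Intersecting with \<open>space M\<close> extends \<open>M\<close> to the Borel sets of the unit interval, the rationals
  getting mass 0. The frontier is the one in the real line; it differs from the one relative to
  the unit interval at most by the endpoints 0 and 1, which have mass 0.
\<close>

definition cf_generates :: "real \<Rightarrow> real measure \<Rightarrow> bool" where
  "cf_generates x M \<longleftrightarrow>
     (\<forall>J. is_interval J \<and> J \<subseteq> {0..1} \<and> measure M (frontier J \<inter> space M) = 0 \<longrightarrow>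
        (\<lambda>N. real (card {n. n < N \<and> (cf_map ^^ n) x \<in> J}) / real N)
          \<longlonglongrightarrow> measure M (J \<inter> space M))"

text \<open>Digits are indexed from 1.\<close>

definition cf_digit :: "real \<Rightarrow> nat \<Rightarrow> nat" where
  "cf_digit x i = nat \<lfloor>1 / (cf_map ^^ (i - 1)) x\<rfloor>"

lemma cf_digit_pos:
  assumes "x \<in> unit_irrationals"
  shows "cf_digit x i > 0"
proof -
  define y where "y = (cf_map ^^ (i - 1)) x"
  have "(cf_map ^^ n) x \<in> unit_irrationals" for n
    by (induction n) (use assms cf_map_in_unit_irrationals in auto)
  hence "y \<in> unit_irrationals"
    by (simp add: y_def)
  hence "0 < y" "y \<le> 1"
    by (auto simp: unit_irrationals_def less_le)
  hence "1 \<le> 1 / y"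
    by simp
  thus ?thesis
    unfolding cf_digit_def y_def [symmetric] by simp
qed

definition cf_irregular :: "real \<Rightarrow> bool" where
  "cf_irregular x \<longleftrightarrow>
     (\<exists>w :: nat list. w \<noteq> [] \<and> (\<forall>d\<in>set w. d > 0) \<and>
        \<not> convergent (\<lambda>N. real (card {i\<in>{1..N}. map (cf_digit x) [i..<i + length w] = w}) / real N))"

end

theory Submission
  imports Defs "HOL-Library.Nat_Bijection" "HOL-Real_Asymp.Real_Asymp"
begin

text \<open>
  Cylinder sets are intervals with rational endpoints and shrink to points, so \<open>x\<close> generates \<open>M\<close>
  iff every word occurs in the expansion of \<open>x\<close> with frequency the measure of its cylinder. Each
  frequency up to a time \<open>N\<close> is a locally constant function of \<open>x\<close>, which gives the upper bounds.

  An invariant \<open>M\<close>, ergodic or not, has a generic point: the word counts along an orbit segment have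
  mean \<open>length * M\<close> by invariance, so segments of lengths 1, 2, 3, \<open>\<dots>\<close> can be chosen one after the
  other such that the deviation from the mean stays of the order of its standard deviation, and
  the segments are concatenated.

  For the lower bounds, overwrite a sequence with prescribed frequencies by a constant digit \<open>c\<close> on
  runs whose relative length in \<open>[4\<^sup>k, 4\<^sup>k\<^sup>+\<^sup>1)\<close> is about \<open>4\<close> to the power \<open>- \<beta> k\<close>. If \<open>\<beta> \<longlonglongrightarrow> \<infinity>\<close> no frequency
  changes, otherwise the frequency of \<open>c\<close> diverges. This continuous reduction suffices, since the
  set of sequences \<open>\<beta>\<close> with \<open>\<beta> \<longlonglongrightarrow> \<infinity>\<close> is not \<open>\<Sigma>\<^sup>0\<^sub>3\<close> by a Baire category argument.
\<close>


section \<open>Sets reducible to divergence to infinity\<close>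

lemma Pi0_2I:
  assumes "\<And>n :: nat. openin X (U n)" "A = topspace X \<inter> (\<Inter>n. U n)"
  shows "A \<in> Pi0 X 2"
proof -
  have "(\<Union>n. topspace X - U n) \<in> Sigma0 X 2"
    unfolding numeral_2_eq_2 using assms(1) by (auto intro!: exI[of _ "\<lambda>n. topspace X - U n"])
  moreover have "A = topspace X - (\<Union>n. topspace X - U n)"
    using assms(2) by auto
  ultimately show ?thesis
    unfolding Pi0_def by blast
qed

lemma Pi0_2E:
  assumes "A \<in> Pi0 X 2"
  obtains U where "\<And>n :: nat. openin X (U n)" "A = topspace X \<inter> (\<Inter>n. U n)"
proof -
  obtain C :: "nat \<Rightarrow> 'a set" where C: "range C \<subseteq> (\<lambda>B. topspace X - B) ` Sigma0 X (Suc 0)"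
    "A = topspace X - \<Union>(range C)"
    using assms by (auto simp: Pi0_def numeral_2_eq_2)
  have "\<forall>n. \<exists>V. openin X V \<and> C n = topspace X - V"
    using C(1) by (auto simp: image_subset_iff)
  then obtain V where V: "\<And>n. openin X (V n)" "\<And>n. C n = topspace X - V n"
    by metis
  show ?thesis
    by (rule that[of V]) (use V C(2) in auto)
qed

lemma Sigma0_3_iff:
  "A \<in> Sigma0 X 3 \<longleftrightarrow> (\<exists>B :: nat \<Rightarrow> 'a set. range B \<subseteq> Pi0 X 2 \<and> A = \<Union>(range B))"
  unfolding numeral_3_eq_3 numeral_2_eq_2 Sigma0_Suc_Suc by auto

text \<open>The countable index type allows indexing by pairs of a word and a precision later on;
  \<open>from_nat\<close> turns it into a sequence.\<close>

lemma Sigma0_3I: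
  fixes U :: "'i :: countable \<Rightarrow> nat \<Rightarrow> 'a set"
  assumes "\<And>i n. openin X (U i n)" "A = (\<Union>i. topspace X \<inter> (\<Inter>n. U i n))"
  shows "A \<in> Sigma0 X 3"
proof -
  have "(\<lambda>n. topspace X \<inter> (\<Inter>k. U (from_nat n) k)) n \<in> Pi0 X 2" for n
    by (rule Pi0_2I[where U = "U (from_nat n)"]) (use assms(1) in auto)
  moreover have "A = (\<Union>n. topspace X \<inter> (\<Inter>k. U (from_nat n) k))"
    using assms(2) by (auto, metis from_nat_to_nat)
  ultimately show ?thesis
    unfolding Sigma0_3_iff
    by (intro exI[of _ "\<lambda>n. topspace X \<inter> (\<Inter>k. U (from_nat n) k)"]) auto
qed

text \<open>Fusion for the two Baire arguments below: stage \<open>j\<close> freezes the first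
  \<open>N j\<close> values, and the limit sequence agrees with every stage on what that stage
  froze.\<close>

lemma sequence_of_prefixes:
  fixes g :: "nat \<Rightarrow> nat \<Rightarrow> 'a" and N :: "nat \<Rightarrow> nat"
  assumes "\<And>j. N j < N (Suc j)" "\<And>j i. i < N j \<Longrightarrow> g (Suc j) i = g j i"
  obtains \<delta> where "\<And>j i. i < N j \<Longrightarrow> \<delta> i = g j i"
proof -
  have mono: "strict_mono N"
    using assms(1) by (simp add: strict_mono_Suc_iff)
  have agree: "g j' i = g j i" if "i < N j" "j \<le> j'" for i j j'
    using that(2)
  proof (induction j' rule: dec_induct)
    case (step n)
    have "N j \<le> N n"
      using step(1) mono by (simp add: strict_mono_less_eq)
    thus ?case
      using step assms(2) that(1) by simp
  qed simp
  show ?thesis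
  \<comment> \<open>As \<open>N\<close> is strictly increasing, position \<open>i\<close> is already
    frozen at stage \<open>Suc i\<close>.\<close>
  proof (rule that[of "\<lambda>i. g (Suc i) i"])
    fix i j assume ij: "i < N j"
    have "i < N (Suc i)"
      using strict_mono_imp_increasing[OF mono, of "Suc i"] by simp
    thus "g (Suc i) i = g j i"
      using agree[of i j "Suc i"] agree[of i "Suc i" j] ij by (cases "j \<le> Suc i") auto
  qed
qed

text \<open>
  A \<open>G\<^sub>\<delta>\<close> set inside \<open>{\<beta>. \<beta> \<longlonglongrightarrow> \<infinity>}\<close> cannot be dense in the closed set of extensions of a
  finite string by values \<open>\<ge> m\<close>, since there the sequences taking the value \<open>m\<close> infinitely
  often are comeagre.
\<close>

lemma Pi0_2_avoid:
  fixes f :: "(nat \<Rightarrow> nat) \<Rightarrow> 'a"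
  assumes cont: "\<And>U \<beta>. openin X U \<Longrightarrow> f \<beta> \<in> U \<Longrightarrow> \<exists>n. \<forall>\<beta>'. (\<forall>i<n. \<beta>' i = \<beta> i) \<longrightarrow> f \<beta>' \<in> U"
    and A: "A \<in> Pi0 X 2" "\<And>\<beta>. f \<beta> \<in> A \<Longrightarrow> filterlim \<beta> at_top sequentially"
  shows "\<exists>\<beta>' n'. n < n' \<and> (\<forall>i<n. \<beta>' i = \<beta> i) \<and> (\<forall>i\<ge>n. m \<le> \<beta>' i) \<and>
    (\<forall>\<gamma>. (\<forall>i<n'. \<gamma> i = \<beta>' i) \<longrightarrow> (\<forall>i\<ge>n'. m \<le> \<gamma> i) \<longrightarrow> f \<gamma> \<notin> A)"
proof (rule ccontr)
  assume no: "\<not> ?thesis"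
  have dense: "\<exists>\<gamma>. (\<forall>i<n'. \<gamma> i = \<beta>' i) \<and> (\<forall>i\<ge>n'. m \<le> \<gamma> i) \<and> f \<gamma> \<in> A"
    if "n < n'" "\<forall>i<n. \<beta>' i = \<beta> i" "\<forall>i\<ge>n. m \<le> \<beta>' i" for \<beta>' n'
  proof (rule ccontr)
    assume "\<not> ?thesis"
    with no that show False by blast
  qed
  obtain U where U: "\<And>j :: nat. openin X (U j)" "A = topspace X \<inter> (\<Inter>j. U j)"
    using Pi0_2E[OF A(1)] by metis
  define P where "P = (\<lambda>(\<gamma>, N). n \<le> N \<and> (\<forall>i<n. \<gamma> i = \<beta> i) \<and> (\<forall>i\<ge>n. m \<le> \<gamma> i))"
  \<comment> \<open>One stage writes another \<open>m\<close> at position \<open>N\<close> and then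
    lengthens the prefix until it forces the image into the open set \<open>U j\<close>.\<close>
  define Q where "Q = (\<lambda>j (\<gamma>, N) (\<gamma>', N'). N < N' \<and> (\<forall>i<N. \<gamma>' i = \<gamma> i) \<and> \<gamma>' N = m \<and>
                      (\<forall>\<delta>. (\<forall>i<N'. \<delta> i = \<gamma>' i) \<longrightarrow> f \<delta> \<in> U j))"
  have "\<exists>p. \<forall>j. P (p j) \<and> Q j (p j) (p (Suc j))"
  proof (rule dependent_nat_choice)
    show "\<exists>p. P p"
      by (rule exI[of _ "(\<lambda>i. if i < n then \<beta> i else m, n)"]) (auto simp: P_def)
  next
    fix p j assume "P p"
    then obtain \<gamma> N where p: "p = (\<gamma>, N)" "n \<le> N" "\<forall>i<n. \<gamma> i = \<beta> i" "\<forall>i\<ge>n. m \<le> \<gamma> i"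
      by (cases p) (auto simp: P_def)
    obtain \<gamma>' where \<gamma>': "\<forall>i<Suc N. \<gamma>' i = (\<gamma>(N := m)) i" "\<forall>i\<ge>Suc N. m \<le> \<gamma>' i" "f \<gamma>' \<in> A"
    proof -
      have "\<forall>i<n. (\<gamma>(N := m)) i = \<beta> i" "\<forall>i\<ge>n. m \<le> (\<gamma>(N := m)) i"
        using p by auto
      with dense[of "Suc N" "\<gamma>(N := m)"] p(2) show ?thesis
        by (blast intro: that le_imp_less_Suc)
    qed
    have low: "\<gamma>' i = \<gamma> i" if "i < N" for i
      using \<gamma>'(1) that by simp
    have mid: "\<gamma>' N = m"
      using \<gamma>'(1) by simp
    obtain N' where N': "\<forall>\<delta>. (\<forall>i<N'. \<delta> i = \<gamma>' i) \<longrightarrow> f \<delta> \<in> U j"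
      using cont[OF U(1)[of j], of \<gamma>'] \<gamma>'(3) U(2) by auto
    have "m \<le> \<gamma>' i" if "n \<le> i" for i
      using that low[of i] mid \<gamma>'(2) p(4) by (cases i N rule: linorder_cases) auto
    hence "P (\<gamma>', max N' (Suc N))"
      using p low by (auto simp: P_def)
    moreover have "Q j p (\<gamma>', max N' (Suc N))"
      using N' low mid by (auto simp: Q_def p(1))
    ultimately show "\<exists>p'. P p' \<and> Q j p p'"
      by blast
  qed
  then obtain p where p: "\<And>j. P (p j)" "\<And>j. Q j (p j) (p (Suc j))"
    by blast
  obtain \<delta> where \<delta>: "\<And>j i. i < snd (p j) \<Longrightarrow> \<delta> i = fst (p j) i"
    by (rule sequence_of_prefixes[of "\<lambda>j. snd (p j)" "\<lambda>j. fst (p j)"])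
       (use p(2) in \<open>auto simp: Q_def case_prod_beta\<close>)
  have "f \<delta> \<in> U j" for j
    using p(2)[of j] \<delta>[of _ "Suc j"] by (auto simp: Q_def case_prod_beta)
  hence "f \<delta> \<in> A"
    using U openin_subset by fastforce
  hence lim: "filterlim \<delta> at_top sequentially"
    by (rule A(2))
  \<comment> \<open>The image of \<open>\<delta>\<close> lies in every \<open>U j\<close>, hence in
    \<open>A\<close>, although \<open>\<delta>\<close> takes the value \<open>m\<close> infinitely
    often.\<close>
  have \<delta>m: "\<delta> (snd (p j)) = m" for j
    using p(2)[of j] \<delta>[of "snd (p j)" "Suc j"] by (auto simp: Q_def case_prod_beta)
  have "strict_mono (\<lambda>j. snd (p j))"
    using p(2) by (auto simp: strict_mono_Suc_iff Q_def case_prod_beta)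
  hence "\<exists>j. K \<le> snd (p j)" for K
    using strict_mono_imp_increasing by blast
  moreover obtain K where "\<And>i. i \<ge> K \<Longrightarrow> \<delta> i \<ge> Suc m"
    using lim unfolding filterlim_at_top eventually_sequentially by blast
  ultimately show False
    using \<delta>m by (metis not_less_eq_eq order_refl)
qed

text \<open>If \<open>P\<close> were the union of sets \<open>A k\<close> of level
  \<open>Pi0 X 2\<close>, prefixes could be extended stage by stage so that the image avoids
  \<open>A k\<close> as long as all later values are at least \<open>k\<close>. The limit tends to
  infinity, but its image lies in no \<open>A k\<close>.\<close>

lemma reduction_not_Sigma0_3:
  fixes f :: "(nat \<Rightarrow> nat) \<Rightarrow> 'a"
  assumes cont: "\<And>U \<beta>. openin X U \<Longrightarrow> f \<beta> \<in> U \<Longrightarrow> \<exists>n. \<forall>\<beta>'. (\<forall>i<n. \<beta>' i = \<beta> i) \<longrightarrow> f \<beta>' \<in> U"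
    and f: "\<And>\<beta>. f \<beta> \<in> P \<longleftrightarrow> filterlim \<beta> at_top sequentially"
  shows "P \<notin> Sigma0 X 3"
proof
  assume "P \<in> Sigma0 X 3"
  then obtain A :: "nat \<Rightarrow> 'a set" where "range A \<subseteq> Pi0 X 2" and P: "P = (\<Union>k. A k)"
    unfolding Sigma0_3_iff by metis
  hence A: "A k \<in> Pi0 X 2" for k
    by auto
  define Q where "Q = (\<lambda>k (\<beta> :: nat \<Rightarrow> nat, n) (\<beta>', n'). n < n' \<and> (\<forall>i<n. \<beta>' i = \<beta> i) \<and> (\<forall>i\<ge>n. k \<le> \<beta>' i) \<and>
     (\<forall>\<gamma>. (\<forall>i<n'. \<gamma> i = \<beta>' i) \<longrightarrow> (\<forall>i\<ge>n'. k \<le> \<gamma> i) \<longrightarrow> f \<gamma> \<notin> A k))"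
  have "\<exists>p'. Q k p p'" for k p
  proof (cases p)
    case (Pair \<beta> n)
    have "filterlim \<gamma> at_top sequentially" if "f \<gamma> \<in> A k" for \<gamma>
      using that f P by auto
    from Pi0_2_avoid[OF cont A this, where n = n and \<beta> = \<beta> and m = k] show ?thesis
      by (simp add: Q_def Pair)
  qed
  then obtain p where p: "\<And>k. Q k (p k) (p (Suc k))"
    using dependent_nat_choice[of "\<lambda>_ _. True" Q] by auto
  obtain \<delta> where \<delta>: "\<And>j i. i < snd (p j) \<Longrightarrow> \<delta> i = fst (p j) i"
    by (rule sequence_of_prefixes[of "\<lambda>j. snd (p j)" "\<lambda>j. fst (p j)"])
       (use p in \<open>auto simp: Q_def case_prod_beta\<close>)
  have mono: "strict_mono (\<lambda>j. snd (p j))"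
    using p by (auto simp: strict_mono_Suc_iff Q_def case_prod_beta)
  \<comment> \<open>The value at \<open>i\<close> is frozen by the first stage \<open>j\<close>
    reaching past \<open>i\<close>. The step leading to it, from a stage \<open>l\<close> with
    \<open>k \<le> l\<close>, only wrote values at least \<open>l\<close> there.\<close>
  have ge: "k \<le> \<delta> i" if i: "snd (p k) \<le> i" for i k
  proof -
    have "\<exists>j. i < snd (p j)"
      using strict_mono_imp_increasing[OF mono, of "Suc i"] by (auto intro!: exI[of _ "Suc i"])
    hence "\<exists>j. i < snd (p j) \<and> (\<forall>l<j. \<not> i < snd (p l))"
      using exists_least_iff[of "\<lambda>j. i < snd (p j)"] by simp
    then obtain j where j: "i < snd (p j)" "\<And>l. l < j \<Longrightarrow> snd (p l) \<le> i"
      by (auto simp: not_less)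
    have "k < j"
    proof (rule ccontr)
      assume "\<not> k < j"
      hence "snd (p j) \<le> snd (p k)"
        using strict_mono_less_eq[OF mono, of j k] by simp
      thus False
        using i j(1) by simp
    qed
    then obtain l where l: "j = Suc l" "k \<le> l"
      by (cases j) auto
    have "l \<le> fst (p j) i"
      using p[of l] j(2)[of l] by (auto simp: Q_def case_prod_beta l)
    thus ?thesis
      using \<delta>[OF j(1)] l by simp
  qed
  have "filterlim \<delta> at_top sequentially"
    unfolding filterlim_at_top eventually_sequentially using ge by blast
  hence "f \<delta> \<in> P"
    using f by blast
  then obtain k where k: "f \<delta> \<in> A k"
    using P by auto
  have "\<forall>i\<ge>snd (p (Suc k)). k \<le> \<delta> i"
    using ge[of "Suc k"] by (meson Suc_leD)
  thus False
    using p[of k] \<delta>[of _ "Suc k"] k by (auto simp: Q_def case_prod_beta)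
qed

section \<open>Continued fraction expansions\<close>

text \<open>Digits counted from 0: \<open>cf_digits x n\<close> is the first digit of the
  \<open>n\<close>th point of the orbit of \<open>x\<close>.\<close>

abbreviation cf_digits :: "real \<Rightarrow> nat \<Rightarrow> nat" where
  "cf_digits x n \<equiv> cf_digit x (Suc n)"

lemma unit_irrationalsD:
  assumes "x \<in> unit_irrationals"
  shows "0 < x" "x < 1" "x \<notin> \<rat>"
  using assms by (auto simp: unit_irrationals_def less_le)

lemma cf_map_funpow_in:
  assumes "x \<in> unit_irrationals"
  shows "(cf_map ^^ n) x \<in> unit_irrationals"
  using assms by (induction n) (auto intro: cf_map_in_unit_irrationals)

lemma cf_digits_shift: "cf_digits ((cf_map ^^ m) x) n = cf_digits x (m + n)"
  by (simp add: cf_digit_def funpow_add[symmetric] add.commute flip: comp_apply[of "cf_map ^^ n"])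

lemma cf_digits_cf_map: "cf_digits (cf_map x) n = cf_digits x (Suc n)"
  using cf_digits_shift[of 1 x n] by simp

lemma inverse_cf_expand:
  assumes "x \<in> unit_irrationals"
  shows "1 / x = cf_digits x 0 + cf_map x"
proof -
  have "0 \<le> \<lfloor>1 / x\<rfloor>"
    using unit_irrationalsD[OF assms] by simp
  thus ?thesis
    by (simp add: cf_digit_def cf_map_def)
qed

lemma cf_expand:
  assumes "x \<in> unit_irrationals"
  shows "x = 1 / (cf_digits x 0 + cf_map x)"
  using unit_irrationalsD[OF assms] by (simp flip: inverse_cf_expand[OF assms])

lemma cf_digit_eqI:
  assumes "x = 1 / (real d + t)" "0 < t" "t < 1"
  shows "cf_digits x 0 = d" "cf_map x = t"
proof -
  have "1 / x = real d + t"
    using assms by simp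
  moreover have "\<lfloor>real d + t\<rfloor> = int d"
    using assms by linarith
  ultimately show "cf_digits x 0 = d" "cf_map x = t"
    by (simp_all add: cf_digit_def cf_map_def)
qed

text \<open>
  Two steps contract by a factor of 4: if \<open>x = 1 / (d + t)\<close> then \<open>x * t = t / (d + t) \<le> 1 / 2\<close>.
\<close>

lemma cf_digits_close:
  assumes "x \<in> unit_irrationals" "y \<in> unit_irrationals"
    and "\<And>i. i < 2 * k \<Longrightarrow> cf_digits x i = cf_digits y i"
  shows "\<bar>x - y\<bar> \<le> (1 / 4) ^ k"
  using assms
proof (induction k arbitrary: x y)
  case 0
  thus ?case
    using unit_irrationalsD[of x] unit_irrationalsD[of y] by auto
next
  case (Suc k)
  have contract: "\<bar>x - y\<bar> = \<bar>cf_map x - cf_map y\<bar> * (x * y)"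
    if "x \<in> unit_irrationals" "y \<in> unit_irrationals" "cf_digits x 0 = cf_digits y 0" for x y
  proof -
    note xy = unit_irrationalsD[OF that(1)] unit_irrationalsD[OF that(2)]
    have "cf_map x - cf_map y = 1 / x - 1 / y"
      using inverse_cf_expand[OF that(1)] inverse_cf_expand[OF that(2)] that(3) by linarith
    also have "\<dots> = (y - x) / (x * y)"
      using xy by (simp add: diff_frac_eq)
    finally have "cf_map x - cf_map y = (y - x) / (x * y)" .
    thus ?thesis
      using xy by (simp add: abs_mult abs_divide abs_minus_commute)
  qed
  have half: "x * cf_map x \<le> 1 / 2" if "x \<in> unit_irrationals" for x
  proof -
    have t: "0 < cf_map x" "cf_map x < 1" "1 \<le> real (cf_digits x 0)"
      using unit_irrationalsD[OF cf_map_in_unit_irrationals[OF that]] cf_digit_pos[OF that, of 1]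
      by auto
    have "x * cf_map x = cf_map x / (cf_digits x 0 + cf_map x)"
      using cf_expand[OF that] by (metis mult.commute times_divide_eq_right mult.right_neutral)
    also have "\<dots> \<le> 1 / 2"
      using t by (simp add: field_simps)
    finally show ?thesis .
  qed
  let ?x = "cf_map x" and ?y = "cf_map y"
  have in': "?x \<in> unit_irrationals" "?y \<in> unit_irrationals"
    "cf_map ?x \<in> unit_irrationals" "cf_map ?y \<in> unit_irrationals"
    using Suc.prems by (auto intro: cf_map_in_unit_irrationals)
  note pos = unit_irrationalsD(1)[OF Suc.prems(1)] unit_irrationalsD(1)[OF Suc.prems(2)]
    unit_irrationalsD(1)[OF in'(1)] unit_irrationalsD(1)[OF in'(2)]
  have IH: "\<bar>cf_map ?x - cf_map ?y\<bar> \<le> (1 / 4) ^ k"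
    using in' Suc.prems(3) by (intro Suc.IH) (auto simp: cf_digits_cf_map)
  have "\<bar>x - y\<bar> = \<bar>cf_map ?x - cf_map ?y\<bar> * ((x * ?x) * (y * ?y))"
    using contract[OF Suc.prems(1,2)] contract[OF in'(1,2)] Suc.prems(3)
    by (simp add: cf_digits_cf_map mult_ac)
  also have "\<dots> \<le> (1 / 4) ^ k * ((1 / 2) * (1 / 2))"
    using IH half[OF Suc.prems(1)] half[OF Suc.prems(2)] pos
    by (intro mult_mono) auto
  finally show ?case
    by simp
qed

section \<open>Words, cylinders and their intervals\<close>

definition occurs :: "(nat \<Rightarrow> nat) \<Rightarrow> nat list \<Rightarrow> nat \<Rightarrow> bool" where
  "occurs s w n \<longleftrightarrow> (\<forall>i<length w. s (n + i) = w ! i)"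

lemma occurs_Nil [simp]: "occurs s [] n"
  by (simp add: occurs_def)

lemma occurs_Cons: "occurs s (d # w) n \<longleftrightarrow> s n = d \<and> occurs s w (Suc n)"
  by (auto simp: occurs_def less_Suc_eq_0_disj)

lemma occurs_iff_map: "occurs s w n \<longleftrightarrow> map s [n..<n + length w] = w"
proof -
  have "map s [n..<n + length w] = w \<longleftrightarrow> (\<forall>i<length w. map s [n..<n + length w] ! i = w ! i)"
    by (subst list_eq_iff_nth_eq) simp
  thus ?thesis
    by (simp add: occurs_def)
qed

lemma occurs_shift: "occurs (\<lambda>n. s (m + n)) w n \<longleftrightarrow> occurs s w (m + n)"
  by (simp add: occurs_def add.assoc)

definition cylinder :: "nat list \<Rightarrow> real set" where
  "cylinder w = {x \<in> unit_irrationals. occurs (cf_digits x) w 0}"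

lemma funpow_in_cylinder_iff:
  assumes "x \<in> unit_irrationals"
  shows "(cf_map ^^ n) x \<in> cylinder w \<longleftrightarrow> occurs (cf_digits x) w n"
  using cf_map_funpow_in[OF assms] occurs_shift[of "cf_digits x" n w 0]
  by (simp add: cylinder_def cf_digits_shift)

text \<open>The image of the closed unit interval under the inverse branches of the continued
  fraction map given by the word. Keeping the endpoints makes compactness available.\<close>

primrec cf_interval :: "nat list \<Rightarrow> real set" where
  "cf_interval [] = {0..1}"
| "cf_interval (d # w) = (\<lambda>t. 1 / (real d + t)) ` cf_interval w"

lemma image_inverse_shift:
  assumes "0 < d" "0 \<le> a" "a \<le> b"
  shows "(\<lambda>t. 1 / (d + t)) ` {a..b} = {1 / (d + b)..1 / (d + a :: real)}"
proof (intro equalityI subsetI)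
  fix x assume "x \<in> {1 / (d + b)..1 / (d + a)}"
  hence x: "1 / (d + b) \<le> x" "x \<le> 1 / (d + a)"
    by auto
  have "0 < 1 / (d + b)"
    using assms by simp
  hence "0 < x"
    using x by linarith
  hence "a \<le> 1 / x - d" "1 / x - d \<le> b"
    using x assms by (auto simp: field_simps)
  thus "x \<in> (\<lambda>t. 1 / (d + t)) ` {a..b}"
    by (intro image_eqI[of _ _ "1 / x - d"]) auto
qed (use assms in \<open>auto intro!: divide_left_mono mult_pos_pos\<close>)

text \<open>The rational endpoints miss \<open>unit_irrationals\<close>; this makes cylinders open
  there and the frontiers of these intervals null.\<close>

lemma cf_interval_eq:
  assumes "\<forall>d\<in>set w. d > 0"
  shows "\<exists>a b. cf_interval w = {a..b} \<and> 0 \<le> a \<and> a \<le> b \<and> b \<le> 1 \<and> a \<in> \<rat> \<and> b \<in> \<rat>"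
  using assms
proof (induction w)
  case Nil
  show ?case
    by (intro exI[of _ 0] exI[of _ 1]) auto
next
  case (Cons d w)
  then obtain a b where ab: "cf_interval w = {a..b}" "0 \<le> a" "a \<le> b" "b \<le> 1" "a \<in> \<rat>" "b \<in> \<rat>"
    by auto
  have d: "1 \<le> real d"
    using Cons.prems by simp
  have "cf_interval (d # w) = {1 / (real d + b)..1 / (real d + a)}"
    using image_inverse_shift[of "real d" a b] ab d by simp
  moreover have "1 / (real d + b) \<le> 1 / (real d + a)" "1 / (real d + a) \<le> 1" "0 \<le> 1 / (real d + b)"
    using ab d by (auto simp: field_simps)
  moreover have "1 / (real d + b) \<in> \<rat>" "1 / (real d + a) \<in> \<rat>"
    using ab by auto
  ultimately show ?case
    by blast
qed

lemma cylinder_eq_interval: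
  assumes "\<forall>d\<in>set w. d > 0"
  shows "cylinder w = cf_interval w \<inter> unit_irrationals"
  using assms
proof (induction w)
  case Nil
  thus ?case
    by (auto simp: cylinder_def unit_irrationals_def)
next
  case (Cons d w)
  have "x \<in> cylinder (d # w) \<longleftrightarrow> x \<in> cf_interval (d # w)" if x: "x \<in> unit_irrationals" for x
  proof
    assume "x \<in> cylinder (d # w)"
    hence "cf_digits x 0 = d" "occurs (cf_digits x) w (Suc 0)"
      by (auto simp: cylinder_def occurs_Cons)
    moreover have "cf_map x \<in> cylinder w"
      using calculation funpow_in_cylinder_iff[OF x, of 1 w] by simp
    ultimately show "x \<in> cf_interval (d # w)"
      using cf_expand[OF x] Cons by auto
  next
    assume "x \<in> cf_interval (d # w)"
    then obtain t where t: "t \<in> cf_interval w" "x = 1 / (real d + t)"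
      by auto
    have "t \<in> {0..1}"
      using cf_interval_eq[of w] Cons.prems t(1) by auto
    moreover have "t \<notin> \<rat>"
      using unit_irrationalsD(3)[OF x] t(2) by auto
    ultimately have tX: "t \<in> unit_irrationals"
      by (simp add: unit_irrationals_def)
    have "cf_digits x 0 = d" "cf_map x = t"
      using cf_digit_eqI[OF t(2)] unit_irrationalsD[OF tX] by auto
    moreover have "t \<in> cylinder w"
      using Cons t(1) tX by simp
    ultimately show "x \<in> cylinder (d # w)"
      using x funpow_in_cylinder_iff[OF x, of 1 w] by (simp add: cylinder_def occurs_Cons)
  qed
  thus ?case
    by (auto simp: cylinder_def)
qed

text \<open>The new digit acts on the innermost unit interval and shrinks it; the outer branches
  preserve the inclusion.\<close>

lemma cf_interval_append:
  assumes "d > 0"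
  shows "cf_interval (w @ [d]) \<subseteq> cf_interval w"
proof (induction w)
  case Nil
  show ?case
    using assms by (auto simp: field_simps)
next
  case (Cons a w)
  thus ?case
    by auto
qed

text \<open>A point of all intervals of \<open>s\<close> is irrational: otherwise its denominator would decrease
  forever along the orbit.\<close>

lemma nested_cf_intervals_irrational:
  assumes "\<And>n. s n > 0" "\<And>k. x \<in> cf_interval (map s [0..<k])"
  shows "x \<notin> \<rat>"
proof -
  have tail: "\<exists>t. x = 1 / (real (s 0) + t) \<and> (\<forall>k. t \<in> cf_interval (map (\<lambda>n. s (Suc n)) [0..<k]))"
    if mem: "\<And>k. x \<in> cf_interval (map s [0..<k])" for s x
  proof (intro exI conjI allI)
    have *: "map s [0..<Suc k] = s 0 # map (\<lambda>n. s (Suc n)) [0..<k]" for k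
      by (simp add: upt_conv_Cons map_Suc_upt[symmetric] del: upt_Suc)
    have inter: "1 / x - s 0 \<in> cf_interval (map (\<lambda>n. s (Suc n)) [0..<k]) \<and> x = 1 / (real (s 0) + (1 / x - s 0))" for k
    proof -
      obtain t where "t \<in> cf_interval (map (\<lambda>n. s (Suc n)) [0..<k])" "x = 1 / (real (s 0) + t)"
        using mem[of "Suc k"] unfolding * by auto
      thus ?thesis
        by auto
    qed
    thus "x = 1 / (real (s 0) + (1 / x - s 0))" "1 / x - s 0 \<in> cf_interval (map (\<lambda>n. s (Suc n)) [0..<k])" for k
      by blast+
  qed
  have "\<not> (\<exists>p. x = real p / real q)"
    if "\<And>n. s n > 0" "\<And>k. x \<in> cf_interval (map s [0..<k])" "q > 0" for s x and q :: nat
    using that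
  proof (induction q arbitrary: s x rule: less_induct)
    case (less q)
    show ?case
    proof
      assume "\<exists>p. x = real p / real q"
      then obtain p where p: "x = real p / real q"
        by blast
      obtain t where t: "x = 1 / (real (s 0) + t)" "\<And>k. t \<in> cf_interval (map (\<lambda>n. s (Suc n)) [0..<k])"
        using tail[of x s] less.prems by blast
      \<comment> \<open>A second digit is unfolded to make \<open>t\<close> strictly positive, which
        gives \<open>x < 1\<close> and hence \<open>p < q\<close>.\<close>
      obtain u where u: "t = 1 / (real (s 1) + u)" "\<And>k. u \<in> cf_interval (map (\<lambda>n. s (Suc (Suc n))) [0..<k])"
        using tail[of t "\<lambda>n. s (Suc n)"] t less.prems by auto
      have s: "1 \<le> real (s 0)" "1 \<le> real (s 1)"
        using less.prems(1)[of 0] less.prems(1)[of 1] by linarith+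
      have "0 \<le> u"
        using u(2)[of 0] by simp
      hence "0 < t"
        using u(1) s by simp
      hence x: "0 < x" "x < 1"
        using t(1) s by simp_all
      hence "0 < p" "p < q"
        using p less.prems(3) by (auto simp: field_simps zero_less_divide_iff)
      \<comment> \<open>The tail \<open>t\<close> of the fraction \<open>p / q\<close> has the
        smaller denominator \<open>p\<close>, so the induction hypothesis applies to it.\<close>
      have "t = 1 / x - s 0"
        using t(1) by simp
      also have "\<dots> = (real q - real (s 0 * p)) / real p"
        using p x \<open>0 < p\<close> \<open>q > 0\<close> by (simp add: field_simps)
      finally have t': "t = (real q - real (s 0 * p)) / real p" .
      hence "s 0 * p \<le> q"
        using \<open>0 < t\<close> \<open>0 < p\<close> by (simp add: zero_less_divide_iff flip: of_nat_mult)
      hence "t = real (q - s 0 * p) / real p"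
        using t' by (simp add: of_nat_diff)
      thus False
        using less.IH[OF \<open>p < q\<close>, of "\<lambda>n. s (Suc n)" t] less.prems(1) t(2) \<open>0 < p\<close> by blast
    qed
  qed
  note not_frac = this[OF assms]
  have "0 \<le> x"
    using assms(2)[of 0] by simp
  show ?thesis
  proof
    assume "x \<in> \<rat>"
    then obtain m n :: nat where "n \<noteq> 0" "\<bar>x\<bar> = real m / real n"
      by (rule Rats_abs_nat_div_natE)
    thus False
      using not_frac[of n] \<open>0 \<le> x\<close> by auto
  qed
qed

text \<open>By compactness the nested intervals of the prefixes of \<open>s\<close> have a common
  point. It is irrational, hence lies in all the corresponding cylinders.\<close>

lemma cf_digits_surj:
  assumes "\<And>n. s n > 0"
  obtains x where "x \<in> unit_irrationals" "cf_digits x = s"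
proof -
  let ?I = "\<lambda>k. cf_interval (map s [0..<k])"
  have dec: "?I n \<subseteq> ?I m" if "m \<le> n" for m n
    using that
  proof (induction n rule: dec_induct)
    case (step n)
    thus ?case
      using cf_interval_append[OF assms, of "map s [0..<n]" n] by auto
  qed simp
  have "\<Inter>(range ?I) \<noteq> {}"
  proof (rule compact_nest[OF _ _ dec])
    fix n
    obtain a b where "?I n = {a..b}" "a \<le> b"
      using cf_interval_eq[of "map s [0..<n]"] assms by auto
    thus "compact (?I n)" "?I n \<noteq> {}"
      by auto
  qed
  then obtain x where x: "\<And>k. x \<in> ?I k"
    by blast
  have "x \<in> unit_irrationals"
    using nested_cf_intervals_irrational[OF assms x] x[of 0] by (simp add: unit_irrationals_def)
  moreover have "cf_digits x n = s n" for n
  proof -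
    have "x \<in> cylinder (map s [0..<Suc n])"
      using cylinder_eq_interval[of "map s [0..<Suc n]"] assms x[of "Suc n"] \<open>x \<in> unit_irrationals\<close>
      by (auto simp del: upt_Suc)
    thus ?thesis
      by (auto simp: cylinder_def occurs_def nth_append less_Suc_eq)
  qed
  ultimately show ?thesis
    using that by blast
qed

section \<open>The topology in terms of digit prefixes\<close>

lemma openin_cylinder: "openin (top_of_set unit_irrationals) (cylinder w)"
proof (cases "\<forall>d\<in>set w. d > 0")
  case True
  then obtain a b where ab: "cf_interval w = {a..b}" "a \<in> \<rat>" "b \<in> \<rat>"
    using cf_interval_eq by blast
  have "cylinder w = unit_irrationals \<inter> {a<..<b}"
  proof -
    have "x \<noteq> a \<and> x \<noteq> b" if "x \<in> unit_irrationals" for x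
      using unit_irrationalsD(3)[OF that] ab by blast
    thus ?thesis
      unfolding cylinder_eq_interval[OF True] ab(1) by fastforce
  qed
  thus ?thesis
    by (simp add: openin_open_Int)
next
  case False
  then obtain i where "i < length w" "w ! i = 0"
    by (auto simp: in_set_conv_nth)
  hence "cylinder w = {}"
    using cf_digit_pos by (auto simp: cylinder_def occurs_def) (metis less_not_refl)
  thus ?thesis
    by simp
qed

text \<open>A condition on the first \<open>k\<close> digits describes a union of cylinders.\<close>

lemma openin_digit_prefix:
  assumes "\<And>x y. x \<in> unit_irrationals \<Longrightarrow> y \<in> unit_irrationals \<Longrightarrow>
             (\<And>i. i < k \<Longrightarrow> cf_digits x i = cf_digits y i) \<Longrightarrow> P x = P y"
  shows "openin (top_of_set unit_irrationals) {x \<in> unit_irrationals. P x}"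
proof -
  let ?c = "\<lambda>x. cylinder (map (cf_digits x) [0..<k])"
  have "{x \<in> unit_irrationals. P x} = (\<Union>x\<in>{x \<in> unit_irrationals. P x}. ?c x)"
  proof (intro equalityI subsetI)
    fix y assume "y \<in> (\<Union>x\<in>{x \<in> unit_irrationals. P x}. ?c x)"
    then obtain x where "x \<in> unit_irrationals" "P x" "y \<in> unit_irrationals"
      "\<And>i. i < k \<Longrightarrow> cf_digits x i = cf_digits y i"
      by (auto simp: cylinder_def occurs_def)
    thus "y \<in> {x \<in> unit_irrationals. P x}"
      using assms[of x y] by blast
  qed (auto simp: cylinder_def occurs_def)
  also have "openin (top_of_set unit_irrationals) \<dots>"
    by (intro openin_Union) (auto intro: openin_cylinder)
  finally show ?thesis .
qed

text \<open>Converse of \<open>openin_digit_prefix\<close>: agreement on \<open>2 * k\<close> digits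
  forces distance at most \<open>(1 / 4) ^ k\<close>.\<close>

lemma openin_cf_digits:
  assumes "openin (top_of_set unit_irrationals) U" "x \<in> U"
  obtains k where "\<And>y. y \<in> unit_irrationals \<Longrightarrow> (\<And>i. i < k \<Longrightarrow> cf_digits y i = cf_digits x i) \<Longrightarrow> y \<in> U"
proof -
  have x: "x \<in> unit_irrationals"
    using assms openin_subset by fastforce
  obtain e where e: "e > 0" "\<And>y. y \<in> unit_irrationals \<Longrightarrow> dist y x < e \<Longrightarrow> y \<in> U"
    using assms by (auto simp: openin_euclidean_subtopology_iff)
  obtain k where k: "(1 / 4) ^ k < e"
    using real_arch_pow_inv[of e "1 / 4"] e(1) by auto
  show ?thesis
  proof (rule that[of "2 * k"])
    fix y assume "y \<in> unit_irrationals" "\<And>i. i < 2 * k \<Longrightarrow> cf_digits y i = cf_digits x i"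
    hence "\<bar>y - x\<bar> \<le> (1 / 4) ^ k"
      by (intro cf_digits_close x)
    thus "y \<in> U"
      using e(2)[OF \<open>y \<in> unit_irrationals\<close>] k by (simp add: dist_real_def)
  qed
qed

section \<open>Frequencies of words\<close>

definition word_freq :: "(nat \<Rightarrow> nat) \<Rightarrow> nat list \<Rightarrow> nat \<Rightarrow> real" where
  "word_freq s w N = real (card {n. n < N \<and> occurs s w n}) / real N"

lemma card_filter_le:
  assumes "{n. n < N \<and> P n} \<subseteq> {n. n < N \<and> Q n} \<union> E" "finite E"
  shows "card {n :: nat. n < N \<and> P n} \<le> card {n. n < N \<and> Q n} + card E"
proof -
  have "card {n. n < N \<and> P n} \<le> card ({n. n < N \<and> Q n} \<union> E)"
    using assms by (intro card_mono) auto
  also have "\<dots> \<le> card {n. n < N \<and> Q n} + card E"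
    by (rule card_Un_le)
  finally show ?thesis .
qed

text \<open>A changed digit affects only the at most \<open>length w\<close> windows covering it.
  The summand \<open>?l * ?l\<close> pays for windows that start before \<open>N\<close> and reach
  changed digits beyond it.\<close>

lemma word_freq_density_zero:
  assumes dens: "(\<lambda>N. real (card (B \<inter> {..<N})) / real N) \<longlonglongrightarrow> 0"
    and eq: "\<And>n. n \<notin> B \<Longrightarrow> s' n = s n"
    and lim: "word_freq s w \<longlonglongrightarrow> L"
  shows "word_freq s' w \<longlonglongrightarrow> L"
proof -
  let ?l = "length w"
  have bound: "\<bar>word_freq s' w N - word_freq s w N\<bar> \<le>
      real ?l * (real (card (B \<inter> {..<N})) / real N) + real (?l * ?l) / real N" for N
  proof -
    define E where "E = (\<Union>i<?l. {n. n < N \<and> n + i \<in> B})"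
    have fin: "finite E"
      by (auto simp: E_def)
    have "card {n. n < N \<and> n + i \<in> B} \<le> card (B \<inter> {..<N}) + ?l" if "i < ?l" for i
    proof -
      have "card {n. n < N \<and> n + i \<in> B} = card ((\<lambda>n. n + i) ` {n. n < N \<and> n + i \<in> B})"
        by (intro card_image[symmetric]) (auto simp: inj_on_def)
      also have "\<dots> \<le> card ((B \<inter> {..<N}) \<union> {N..<N + i})"
        by (intro card_mono) auto
      also have "\<dots> \<le> card (B \<inter> {..<N}) + i"
        using card_Un_le[of "B \<inter> {..<N}" "{N..<N + i}"] by simp
      finally show ?thesis
        using that by simp
    qed
    hence "card E \<le> (\<Sum>i<?l. card (B \<inter> {..<N}) + ?l)"
      unfolding E_def by (intro order_trans[OF card_UN_le] sum_mono) auto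
    hence E: "real (card E) \<le> real ?l * real (card (B \<inter> {..<N})) + real (?l * ?l)"
      by (simp add: algebra_simps flip: of_nat_mult of_nat_add)
    have occ: "occurs s' w n \<longleftrightarrow> occurs s w n" if "n < N" "n \<notin> E" for n
      using that eq by (auto simp: E_def occurs_def)
    have "\<bar>real (card {n. n < N \<and> occurs s' w n}) - real (card {n. n < N \<and> occurs s w n})\<bar> \<le> card E"
      using card_filter_le[of N "occurs s w" "occurs s' w" E] card_filter_le[of N "occurs s' w" "occurs s w" E]
        occ fin by fastforce
    hence "\<bar>word_freq s' w N - word_freq s w N\<bar> \<le> card E / real N"
      by (simp add: word_freq_def divide_right_mono flip: diff_divide_distrib)
    also have "\<dots> \<le> (real ?l * real (card (B \<inter> {..<N})) + real (?l * ?l)) / real N"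
      using E by (intro divide_right_mono) auto
    finally show ?thesis
      by (simp add: add_divide_distrib)
  qed
  have "(\<lambda>N. real ?l * (real (card (B \<inter> {..<N})) / real N) + real (?l * ?l) / real N) \<longlonglongrightarrow> real ?l * 0 + 0"
    by (intro tendsto_add tendsto_mult tendsto_const dens lim_const_over_n)
  hence "(\<lambda>N. real ?l * (real (card (B \<inter> {..<N})) / real N) + real (?l * ?l) / real N) \<longlonglongrightarrow> 0"
    by simp
  hence "(\<lambda>N. word_freq s' w N - word_freq s w N) \<longlonglongrightarrow> 0"
    by (rule Lim_null_comparison[rotated]) (use bound in \<open>simp only: real_norm_def eventually_True\<close>)
  from tendsto_add[OF this lim] show ?thesis
    by simp
qed

text \<open>
  The run at the end of \<open>[4\<^sup>k, 4\<^sup>k\<^sup>+\<^sup>1)\<close> has relative length about \<open>4 powr (- \<beta> k)\<close>, and it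
  leaves the interval \<open>[4\<^sup>k, 3 * 4\<^sup>k)\<close> untouched.
\<close>

definition run :: "nat \<Rightarrow> nat \<Rightarrow> nat set" where
  "run k b = {4 ^ Suc k - 4 ^ (k - b)..<4 ^ Suc k}"

definition runs :: "(nat \<Rightarrow> nat) \<Rightarrow> nat set" where
  "runs \<beta> = (\<Union>k. run k (\<beta> k))"

definition perturb :: "(nat \<Rightarrow> nat) \<Rightarrow> nat \<Rightarrow> (nat \<Rightarrow> nat) \<Rightarrow> nat \<Rightarrow> nat" where
  "perturb s c \<beta> n = (if n \<in> runs \<beta> then c else s n)"

section \<open>Location and density of the runs\<close>

lemma self_le_power4: "k \<le> 4 ^ k" for k :: nat
proof -
  have "k \<le> 2 ^ k"
    by (rule less_imp_le[OF less_exp])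
  also have "(2 :: nat) ^ k \<le> 4 ^ k"
    by (intro power_mono) auto
  finally show ?thesis .
qed

lemma run_bounds:
  assumes "n \<in> run k b"
  shows "3 * 4 ^ k \<le> n" "n < 4 ^ Suc k"
proof -
  have "(4 :: nat) ^ (k - b) \<le> 4 ^ k"
    by (intro power_increasing) auto
  hence "3 * 4 ^ k \<le> (4 :: nat) ^ Suc k - 4 ^ (k - b)"
    unfolding power_Suc by linarith
  thus "3 * 4 ^ k \<le> n" "n < 4 ^ Suc k"
    using assms by (auto simp: run_def)
qed

text \<open>Source of the continuity of the reduction: run \<open>k\<close> starts beyond
  \<open>4 ^ k \<ge> k\<close>, so membership of \<open>j\<close> depends only on values of the
  parameter at indices up to \<open>j\<close>.\<close>

lemma runs_cong:
  assumes "\<And>i. i < n \<Longrightarrow> \<beta>' i = \<beta> i" "j < n"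
  shows "j \<in> runs \<beta>' \<longleftrightarrow> j \<in> runs \<beta>"
proof -
  have "k < n" if "j \<in> run k b" for k b
  proof -
    have "k \<le> 4 ^ k"
      by (rule self_le_power4)
    also have "4 ^ k \<le> j"
      using run_bounds(1)[OF that] by linarith
    finally show ?thesis
      using assms(2) by simp
  qed
  hence "j \<in> run k (\<beta>' k) \<longleftrightarrow> j \<in> run k (\<beta> k)" for k
    using assms(1)[of k] by metis
  thus ?thesis
    by (simp add: runs_def)
qed

lemma finite_power4_le: "finite {k. 3 * 4 ^ k \<le> (N :: nat)}"
proof (rule finite_subset)
  have "k \<le> N" if "3 * 4 ^ k \<le> N" for k
    using that self_le_power4[of k] by linarith
  thus "{k. 3 * 4 ^ k \<le> N} \<subseteq> {..N}"
    by blast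
qed simp

text \<open>Only scales with \<open>3 * 4 ^ k \<le> N\<close> have runs meeting
  \<open>{..<N}\<close>, and the geometric sum is dominated by its last term.\<close>

lemma sum_power4_le: "(\<Sum>k\<in>{k. 3 * 4 ^ k \<le> N}. 4 ^ k) \<le> (N :: nat)"
proof (cases "{k. 3 * 4 ^ k \<le> N} = {}")
  case False
  note fin = finite_power4_le[of N]
  define a where "a = Max {k. 3 * 4 ^ k \<le> N}"
  have a: "3 * 4 ^ a \<le> N"
    using Max_in[OF fin False] by (simp add: a_def)
  have "(\<Sum>k\<in>{k. 3 * 4 ^ k \<le> N}. 4 ^ k) \<le> (\<Sum>k\<le>a. 4 ^ k :: nat)"
    using fin by (intro sum_mono2) (auto simp: a_def)
  also have "\<dots> \<le> 3 * 4 ^ a"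
    by (induction a) auto
  finally show ?thesis
    using a by simp
qed simp

text \<open>Scales below \<open>K\<close> cost at most \<open>4 ^ K\<close>; from \<open>K\<close>
  on, a run has at most \<open>4 ^ k / 4 ^ m\<close> elements. The hypothesis
  \<open>m \<le> K\<close> makes the natural subtraction \<open>k - m\<close> exact.\<close>

lemma card_runs_le:
  assumes "\<And>k. K \<le> k \<Longrightarrow> m \<le> \<beta> k" "m \<le> K"
  shows "real (card (runs \<beta> \<inter> {..<N})) \<le> 4 ^ K + real N / 4 ^ m"
proof -
  let ?D = "{k. 3 * 4 ^ k \<le> N} \<inter> {K..}"
  note fin = finite_power4_le[of N]
  have "runs \<beta> \<inter> {..<N} \<subseteq> {..<4 ^ K} \<union> (\<Union>k\<in>?D. run k (\<beta> k))"
  proof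
    fix n assume "n \<in> runs \<beta> \<inter> {..<N}"
    then obtain k where k: "n \<in> run k (\<beta> k)" "n < N"
      by (auto simp: runs_def)
    show "n \<in> {..<4 ^ K} \<union> (\<Union>k\<in>?D. run k (\<beta> k))"
    proof (cases "K \<le> k")
      case True
      thus ?thesis
        using k run_bounds(1)[OF k(1)] by auto
    next
      case False
      hence "(4 :: nat) ^ Suc k \<le> 4 ^ K"
        by (intro power_increasing) auto
      thus ?thesis
        using run_bounds(2)[OF k(1)] by simp
    qed
  qed
  hence "card (runs \<beta> \<inter> {..<N}) \<le> card ({..<4 ^ K} \<union> (\<Union>k\<in>?D. run k (\<beta> k)))"
    using fin by (intro card_mono) (auto simp: run_def)
  also have "\<dots> \<le> 4 ^ K + (\<Sum>k\<in>?D. card (run k (\<beta> k)))"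
    using fin by (intro order_trans[OF card_Un_le] add_mono card_UN_le) auto
  finally have "real (card (runs \<beta> \<inter> {..<N})) \<le> real (4 ^ K + (\<Sum>k\<in>?D. card (run k (\<beta> k))))"
    by (simp only: of_nat_le_iff)
  also have "\<dots> = 4 ^ K + (\<Sum>k\<in>?D. real (card (run k (\<beta> k))))"
    by simp
  also have "(\<Sum>k\<in>?D. real (card (run k (\<beta> k)))) \<le> (\<Sum>k\<in>?D. real (4 ^ k) / 4 ^ m)"
  proof (intro sum_mono)
    fix k assume "k \<in> ?D"
    hence k: "m \<le> \<beta> k" "m \<le> k"
      using assms by auto
    have "card (run k (\<beta> k)) \<le> 4 ^ (k - \<beta> k)"
      by (simp add: run_def)
    also have "\<dots> \<le> 4 ^ (k - m)"
      using k by (intro power_increasing) auto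
    finally have "real (card (run k (\<beta> k))) \<le> real (4 ^ (k - m))"
      by (simp only: of_nat_le_iff)
    also have "\<dots> = real (4 ^ k) / 4 ^ m"
      using power_diff[of "4 :: real" m k] k by simp
    finally show "real (card (run k (\<beta> k))) \<le> real (4 ^ k) / 4 ^ m" .
  qed
  also have "\<dots> = real (\<Sum>k\<in>?D. 4 ^ k) / 4 ^ m"
    by (simp add: sum_divide_distrib)
  also have "\<dots> \<le> real N / 4 ^ m"
  proof (intro divide_right_mono)
    have "(\<Sum>k\<in>?D. 4 ^ k) \<le> (\<Sum>k\<in>{k. 3 * 4 ^ k \<le> N}. 4 ^ k :: nat)"
      using fin by (intro sum_mono2) auto
    thus "real (\<Sum>k\<in>?D. 4 ^ k) \<le> real N"
      using sum_power4_le[of N] by (simp only: of_nat_le_iff)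
  qed auto
  finally show ?thesis
    by simp
qed

lemma runs_density_zero:
  assumes "filterlim \<beta> at_top sequentially"
  shows "(\<lambda>N. real (card (runs \<beta> \<inter> {..<N})) / real N) \<longlonglongrightarrow> 0"
proof (rule LIMSEQ_I)
  fix e :: real assume e: "e > 0"
  obtain m where m: "(1 / 4) ^ m < e / 2"
    using real_arch_pow_inv[of "e / 2" "1 / 4"] e by auto
  obtain K0 where K0: "\<And>k. k \<ge> K0 \<Longrightarrow> m \<le> \<beta> k"
    using assms unfolding filterlim_at_top eventually_sequentially by blast
  define K where "K = max K0 m"
  obtain N0 :: nat where N0: "4 ^ K * 2 / e < real N0"
    using reals_Archimedean2 by blast
  show "\<exists>N0. \<forall>N\<ge>N0. norm (real (card (runs \<beta> \<inter> {..<N})) / real N - 0) < e"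
  proof (intro exI allI impI)
    fix N assume N: "N \<ge> Suc N0"
    hence pos: "real N > 0"
      by simp
    have "4 ^ K * 2 / e < real N"
      using N N0 by linarith
    hence "4 ^ K / real N < e / 2"
      using e pos by (simp add: field_simps)
    moreover have "real (card (runs \<beta> \<inter> {..<N})) / real N \<le> (4 ^ K + real N / 4 ^ m) / real N"
      using K0 by (intro divide_right_mono card_runs_le) (auto simp: K_def)
    moreover have "(4 ^ K + real N / 4 ^ m) / real N = 4 ^ K / real N + (1 / 4) ^ m"
      using pos by (simp add: add_divide_distrib power_divide)
    ultimately show "norm (real (card (runs \<beta> \<inter> {..<N})) / real N - 0) < e"
      using m by simp
  qed
qed

lemma perturb_word_freq:
  assumes "filterlim \<beta> at_top sequentially" "word_freq s w \<longlonglongrightarrow> L"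
  shows "word_freq (perturb s c \<beta>) w \<longlonglongrightarrow> L"
  by (rule word_freq_density_zero[OF runs_density_zero[OF assms(1)] _ assms(2)])
     (simp add: perturb_def)

lemma word_freq_singleton_split:
  assumes "a \<le> b"
  shows "real b * word_freq s [c] b = real a * word_freq s [c] a + real (card {n\<in>{a..<b}. s n = c})"
proof -
  have *: "real N * word_freq s [c] N = real (card {n. n < N \<and> s n = c})" for N
    by (cases "N = 0") (simp_all add: word_freq_def occurs_def)
  have eq: "{n. n < b \<and> s n = c} = {n. n < a \<and> s n = c} \<union> {n\<in>{a..<b}. s n = c}"
    using assms by auto
  have "card {n. n < b \<and> s n = c} = card {n. n < a \<and> s n = c} + card {n\<in>{a..<b}. s n = c}"
    unfolding eq by (rule card_Un_disjoint) auto
  thus ?thesis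
    unfolding * by simp
qed

text \<open>
  The untouched intervals \<open>[4\<^sup>k, 3 * 4\<^sup>k)\<close> force a limit of the frequency of \<open>c\<close> to be \<open>L\<close>,
  while infinitely many runs of non-vanishing relative length force it to be 1.
\<close>

lemma perturb_not_convergent:
  assumes "\<not> filterlim \<beta> at_top sequentially" "word_freq s [c] \<longlonglongrightarrow> L" "L \<noteq> 1"
  shows "\<not> convergent (word_freq (perturb s c \<beta>) [c])"
proof
  let ?s = "perturb s c \<beta>"
  assume "convergent (word_freq ?s [c])"
  then obtain p where p: "word_freq ?s [c] \<longlonglongrightarrow> p"
    by (auto simp: convergent_def)
  have sub: "(\<lambda>k. f (g k)) \<longlonglongrightarrow> l" if "f \<longlonglongrightarrow> l" "\<And>k. k \<le> g k" for f :: "nat \<Rightarrow> real" and g l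
    using that by (intro filterlim_compose[OF that(1)] filterlim_at_top_mono[OF filterlim_ident]) auto
  note k4 = self_le_power4
  have untouched: "3 * word_freq ?s [c] (3 * 4 ^ k) - word_freq ?s [c] (4 ^ k) =
        3 * word_freq s [c] (3 * 4 ^ k) - word_freq s [c] (4 ^ k)" for k
  proof -
    have "n \<notin> runs \<beta>" if n: "n \<in> {4 ^ k..<3 * 4 ^ k}" for n
    proof
      assume "n \<in> runs \<beta>"
      then obtain j where j: "n \<in> run j (\<beta> j)"
        by (auto simp: runs_def)
      have "(4 :: nat) ^ j < 4 ^ k"
        using run_bounds(1)[OF j] n unfolding atLeastLessThan_iff by linarith
      hence "Suc j \<le> k"
        by simp
      hence "(4 :: nat) ^ Suc j \<le> 4 ^ k"
        by (intro power_increasing) auto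
      thus False
        using run_bounds(2)[OF j] n by auto
    qed
    hence "{n\<in>{4 ^ k..<3 * 4 ^ k}. ?s n = c} = {n\<in>{4 ^ k..<3 * 4 ^ k}. s n = c}"
      by (auto simp: perturb_def)
    hence "real (3 * 4 ^ k) * word_freq ?s [c] (3 * 4 ^ k) - real (4 ^ k) * word_freq ?s [c] (4 ^ k) =
           real (3 * 4 ^ k) * word_freq s [c] (3 * 4 ^ k) - real (4 ^ k) * word_freq s [c] (4 ^ k)"
      using word_freq_singleton_split[of "4 ^ k" "3 * 4 ^ k" ?s c]
        word_freq_singleton_split[of "4 ^ k" "3 * 4 ^ k" s c] by simp
    hence "4 ^ k * (3 * word_freq ?s [c] (3 * 4 ^ k) - word_freq ?s [c] (4 ^ k)) =
           4 ^ k * (3 * word_freq s [c] (3 * 4 ^ k) - word_freq s [c] (4 ^ k))"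
      by (simp add: algebra_simps)
    thus ?thesis
      by simp
  qed
  have lims: "(\<lambda>k. 3 * f (3 * 4 ^ k) - f (4 ^ k)) \<longlonglongrightarrow> 3 * l - l" if "f \<longlonglongrightarrow> l" for f :: "nat \<Rightarrow> real" and l
    using k4 by (intro tendsto_intros sub[OF that]) (auto intro: order_trans[OF k4])
  have "3 * p - p = 3 * L - L"
    using LIMSEQ_unique[OF lims[OF p, unfolded untouched] lims[OF assms(2)]] .
  hence "p = L"
    by simp
  obtain m where m: "\<And>K. \<exists>k\<ge>K. \<beta> k \<le> m"
    using assms(1) unfolding filterlim_at_top eventually_sequentially by (metis nle_le)
  \<comment> \<open>If \<open>\<beta> k \<le> m \<le> k\<close>, the last \<open>4 ^ (k - m)\<close>
    positions before \<open>4 ^ Suc k\<close> all carry \<open>c\<close>; they begin at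
    \<open>g k\<close>, and \<open>r\<close> is their share of \<open>4 ^ Suc k\<close>.\<close>
  define g where "g = (\<lambda>k. 4 ^ Suc k - 4 ^ (k - m) :: nat)"
  define r :: real where "r = 1 / 4 ^ Suc m"
  have r: "r > 0"
    by (simp add: r_def)
  have pow: "(4 :: nat) ^ (k - m) \<le> 4 ^ k" for k
    by (intro power_increasing) auto
  have gle: "k \<le> g k" "g k \<le> 4 ^ Suc k" for k
    using pow[of k] k4[of k] unfolding g_def power_Suc by linarith+
  have eq: "word_freq ?s [c] (4 ^ Suc k) = (1 - r) * word_freq ?s [c] (g k) + r"
    if "\<beta> k \<le> m" "m \<le> k" for k
  proof -
    have "(4 :: nat) ^ (k - m) \<le> 4 ^ (k - \<beta> k)"
      using that by (intro power_increasing) auto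
    hence "4 ^ Suc k - 4 ^ (k - \<beta> k) \<le> g k"
      unfolding g_def by linarith
    hence "n \<in> runs \<beta>" if "n \<in> {g k..<4 ^ Suc k}" for n
      using that by (auto simp: runs_def run_def intro!: exI[of _ k])
    hence "{n\<in>{g k..<4 ^ Suc k}. ?s n = c} = {g k..<4 ^ Suc k}"
      by (auto simp: perturb_def)
    hence "card {n\<in>{g k..<4 ^ Suc k}. ?s n = c} = 4 ^ (k - m)"
      using pow[of k] unfolding g_def power_Suc by (simp only: card_atLeastLessThan)
    hence "real (4 ^ Suc k) * word_freq ?s [c] (4 ^ Suc k) = real (g k) * word_freq ?s [c] (g k) + 4 ^ (k - m)"
      using word_freq_singleton_split[OF gle(2)[of k], of ?s c] by simp
    moreover have "(4 :: real) ^ (k - m) = 4 ^ Suc k * r"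
      using that by (simp add: r_def power_diff)
    moreover have "real (g k) = 4 ^ Suc k * (1 - r)"
    proof -
      have "g k + 4 ^ (k - m) = 4 ^ Suc k"
        using pow[of k] unfolding g_def power_Suc by linarith
      hence "real (g k + 4 ^ (k - m)) = real (4 ^ Suc k)"
        by (simp only:)
      thus ?thesis
        using calculation(2) by (simp add: algebra_simps)
    qed
    ultimately have "4 ^ Suc k * word_freq ?s [c] (4 ^ Suc k) =
        4 ^ Suc k * ((1 - r) * word_freq ?s [c] (g k) + r)"
      by (simp add: algebra_simps)
    thus ?thesis
      by simp
  qed
  let ?d = "\<lambda>k. word_freq ?s [c] (4 ^ Suc k) - ((1 - r) * word_freq ?s [c] (g k) + r)"
  have "?d \<longlonglongrightarrow> p - ((1 - r) * p + r)"
    using gle k4 by (intro tendsto_intros sub[OF p]) (auto intro: order_trans[OF k4])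
  hence lim: "?d \<longlonglongrightarrow> r * (p - 1)"
    by (simp add: algebra_simps)
  \<comment> \<open>By \<open>eq\<close>, \<open>?d\<close> vanishes for infinitely many
    \<open>k\<close>, so its limit cannot be nonzero.\<close>
  have "r * (p - 1) = 0"
  proof (rule ccontr)
    assume "r * (p - 1) \<noteq> 0"
    hence "eventually (\<lambda>k. ?d k \<noteq> 0) sequentially"
      by (rule tendsto_imp_eventually_ne[OF lim])
    then obtain K where K: "\<And>k. k \<ge> K \<Longrightarrow> ?d k \<noteq> 0"
      by (auto simp: eventually_sequentially)
    obtain k where "k \<ge> max K m" "\<beta> k \<le> m"
      using m by blast
    thus False
      using K[of k] eq[of k] by simp
  qed
  thus False
    using r \<open>p = L\<close> assms(3) by simp
qed

section \<open>Generic points and cylinders\<close>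

lemma openin_sets:
  assumes "sets M = sets (restrict_space borel unit_irrationals)"
    and "openin (top_of_set unit_irrationals) U"
  shows "U \<in> sets M"
  using assms by (auto simp: openin_open sets_restrict_space)

lemma cylinder_sets:
  assumes "sets M = sets (restrict_space borel unit_irrationals)"
  shows "cylinder w \<in> sets M"
  using assms openin_cylinder by (rule openin_sets)

lemma space_unit_irrationals:
  assumes "sets M = sets (restrict_space borel unit_irrationals)"
  shows "space M = unit_irrationals"
  using sets_eq_imp_space_eq[OF assms] by (simp add: space_restrict_space)

lemma cylinder_disjoint:
  assumes "length v = length w" "v \<noteq> w"
  shows "cylinder v \<inter> cylinder w = {}"
  using assms by (auto simp: cylinder_def occurs_iff_map)

lemma occurs_same_length:
  assumes "length v = length w" "occurs s v n" "occurs s w n"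
  shows "v = w"
  using assms by (simp add: occurs_iff_map)

text \<open>The lower half of a portmanteau argument: finitely many disjoint cylinders inside
  \<open>U\<close> carry almost all of its mass, and their frequencies add up.\<close>

lemma liminf_orbit_open:
  fixes U :: "real set"
  assumes M: "sets M = sets (restrict_space borel unit_irrationals)" "prob_space M"
    and x: "x \<in> unit_irrationals"
    and freq: "\<And>w. word_freq (cf_digits x) w \<longlonglongrightarrow> measure M (cylinder w)"
    and U: "open U" and e: "e > 0"
  shows "eventually (\<lambda>N. measure M (U \<inter> space M) - e <
           real (card {n. n < N \<and> (cf_map ^^ n) x \<in> U}) / real N) sequentially"
proof -
  interpret prob_space M by fact
  note space = space_unit_irrationals[OF M(1)]
  note cyl [measurable] = cylinder_sets[OF M(1)]
  \<comment> \<open>Exhaustion in two parameters: the common length \<open>k\<close> keeps the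
    cylinders disjoint, and the bound \<open>n\<close> on the codes leaves finitely many
    words.\<close>
  define W where "W = (\<lambda>k n. {w. to_nat w < n \<and> length w = k \<and> cylinder w \<subseteq> U})"
  define V where "V = (\<lambda>k. \<Union>n. \<Union>w\<in>W k n. cylinder w)"
  have finW: "finite (W k n)" for k n
  proof (rule finite_subset)
    show "W k n \<subseteq> from_nat ` {..<n}"
      by (force simp: W_def)
  qed simp
  have mem_V: "y \<in> V k \<longleftrightarrow> y \<in> unit_irrationals \<and> cylinder (map (cf_digits y) [0..<k]) \<subseteq> U" for y k
  proof
    assume "y \<in> V k"
    then obtain w where "length w = k" "cylinder w \<subseteq> U" "y \<in> cylinder w"
      by (auto simp: V_def W_def)
    thus "y \<in> unit_irrationals \<and> cylinder (map (cf_digits y) [0..<k]) \<subseteq> U"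
      by (auto simp: cylinder_def occurs_iff_map)
  next
    assume y: "y \<in> unit_irrationals \<and> cylinder (map (cf_digits y) [0..<k]) \<subseteq> U"
    hence "map (cf_digits y) [0..<k] \<in> W k (Suc (to_nat (map (cf_digits y) [0..<k])))"
      by (simp add: W_def)
    moreover have "y \<in> cylinder (map (cf_digits y) [0..<k])"
      using y by (simp add: cylinder_def occurs_iff_map)
    ultimately show "y \<in> V k"
      unfolding V_def by blast
  qed
  have V_sets: "V k \<in> sets M" for k
    unfolding V_def using finW by (intro sets.countable_UN) (auto intro!: sets.finite_UN)
  have "incseq V"
  proof (rule incseq_SucI, rule subsetI)
    fix k y assume "y \<in> V k"
    moreover have "cylinder (map (cf_digits y) [0..<Suc k]) \<subseteq> cylinder (map (cf_digits y) [0..<k])"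
      by (auto simp: cylinder_def occurs_def nth_append)
    ultimately show "y \<in> V (Suc k)"
      unfolding mem_V by blast
  qed
  hence "(\<lambda>k. measure M (V k)) \<longlonglongrightarrow> measure M (\<Union>k. V k)"
    using V_sets by (intro finite_Lim_measure_incseq) auto
  moreover have "(\<Union>k. V k) = U \<inter> space M"
  proof (intro equalityI subsetI)
    fix y assume "y \<in> (\<Union>k. V k)"
    then obtain k where "y \<in> V k"
      by blast
    thus "y \<in> U \<inter> space M"
      unfolding V_def W_def space by (auto simp: cylinder_def)
  next
    fix y assume y: "y \<in> U \<inter> space M"
    have "openin (top_of_set unit_irrationals) (unit_irrationals \<inter> U)"
      using U by (rule openin_open_Int)
    then obtain k where k: "\<And>z. z \<in> unit_irrationals \<Longrightarrow> (\<And>i. i < k \<Longrightarrow> cf_digits z i = cf_digits y i) \<Longrightarrow>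
        z \<in> unit_irrationals \<inter> U"
      using openin_cf_digits[of "unit_irrationals \<inter> U" y] y space by (metis Int_commute)
    have "y \<in> V k"
      unfolding mem_V using k y space by (auto simp: cylinder_def occurs_def)
    thus "y \<in> (\<Union>k. V k)"
      by blast
  qed
  ultimately have "eventually (\<lambda>k. measure M (U \<inter> space M) - e / 2 < measure M (V k)) sequentially"
    using e by (intro order_tendstoD) auto
  from eventually_happens'[OF sequentially_bot this]
  obtain k where k: "measure M (U \<inter> space M) - e / 2 < measure M (V k)"
    by blast
  have "incseq (\<lambda>n. \<Union>w\<in>W k n. cylinder w)"
    by (intro incseq_SucI UN_mono) (auto simp: W_def)
  hence "(\<lambda>n. measure M (\<Union>w\<in>W k n. cylinder w)) \<longlonglongrightarrow> measure M (V k)"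
    unfolding V_def using finW by (intro finite_Lim_measure_incseq) (auto intro!: sets.finite_UN)
  hence "eventually (\<lambda>n. measure M (V k) - e / 2 < measure M (\<Union>w\<in>W k n. cylinder w)) sequentially"
    using e by (intro order_tendstoD) auto
  from eventually_happens'[OF sequentially_bot this]
  obtain n where n: "measure M (V k) - e / 2 < measure M (\<Union>w\<in>W k n. cylinder w)"
    by blast
  have W_len: "length w = k" if "w \<in> W k n" for w
    using that by (simp add: W_def)
  have "disjoint_family_on cylinder (W k n)"
    unfolding disjoint_family_on_def using W_len cylinder_disjoint by metis
  hence "measure M (\<Union>w\<in>W k n. cylinder w) = (\<Sum>w\<in>W k n. measure M (cylinder w))"
    using finW by (intro finite_measure_finite_Union) auto
  hence sum_gt: "measure M (U \<inter> space M) - e < (\<Sum>w\<in>W k n. measure M (cylinder w))"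
    using k n by linarith
  have "(\<lambda>N. \<Sum>w\<in>W k n. word_freq (cf_digits x) w N) \<longlonglongrightarrow> (\<Sum>w\<in>W k n. measure M (cylinder w))"
    by (intro tendsto_sum freq)
  hence ev: "eventually (\<lambda>N. measure M (U \<inter> space M) - e < (\<Sum>w\<in>W k n. word_freq (cf_digits x) w N)) sequentially"
    using sum_gt by (rule order_tendstoD)
  have le: "(\<Sum>w\<in>W k n. word_freq (cf_digits x) w N) \<le>
      real (card {i. i < N \<and> (cf_map ^^ i) x \<in> U}) / real N" for N
  proof -
    have "(\<Sum>w\<in>W k n. card {i. i < N \<and> occurs (cf_digits x) w i}) =
          card (\<Union>w\<in>W k n. {i. i < N \<and> occurs (cf_digits x) w i})"
    proof (rule card_UN_disjoint[symmetric])
      show "\<forall>v\<in>W k n. \<forall>w\<in>W k n. v \<noteq> w \<longrightarrow>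
              {i. i < N \<and> occurs (cf_digits x) v i} \<inter> {i. i < N \<and> occurs (cf_digits x) w i} = {}"
        using W_len occurs_same_length by blast
    qed (use finW in auto)
    also have "\<dots> \<le> card {i. i < N \<and> (cf_map ^^ i) x \<in> U}"
      by (intro card_mono) (auto simp: W_def simp flip: funpow_in_cylinder_iff[OF x])
    finally have "real (\<Sum>w\<in>W k n. card {i. i < N \<and> occurs (cf_digits x) w i}) \<le>
        real (card {i. i < N \<and> (cf_map ^^ i) x \<in> U})"
      by (simp only: of_nat_le_iff)
    thus ?thesis
      by (simp add: word_freq_def divide_right_mono flip: sum_divide_distrib)
  qed
  show ?thesis
    using ev by eventually_elim (use le in \<open>meson less_le_trans\<close>)
qed

text \<open>The lower bounds for the open sets \<open>interior J\<close> and
  \<open>- closure J\<close> squeeze the frequency of \<open>J\<close>, because a null frontier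
  gives interior and closure equal mass.\<close>

lemma cf_generatesI:
  assumes M: "sets M = sets (restrict_space borel unit_irrationals)" "prob_space M"
    and x: "x \<in> unit_irrationals"
    and freq: "\<And>w. word_freq (cf_digits x) w \<longlonglongrightarrow> measure M (cylinder w)"
  shows "cf_generates x M"
  unfolding cf_generates_def
proof (intro allI impI, elim conjE)
  fix J :: "real set"
  assume J: "is_interval J" "measure M (frontier J \<inter> space M) = 0"
  interpret prob_space M by fact
  note space = space_unit_irrationals[OF M(1)]
  have borel_sets: "B \<inter> space M \<in> sets M" if "B \<in> sets borel" for B
    using that M(1) by (auto simp: sets_restrict_space space)
  have meas [measurable]: "interior J \<inter> space M \<in> sets M" "J \<inter> space M \<in> sets M"
    "closure J \<inter> space M \<in> sets M" "frontier J \<inter> space M \<in> sets M" "- closure J \<inter> space M \<in> sets M"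
    by (intro borel_sets borel_closed borel_open real_interval_borel_measurable J(1) frontier_closed
        open_interior closed_closure open_Compl)+
  let ?m = "measure M (J \<inter> space M)"
  have "measure M (closure J \<inter> space M) \<le> measure M ((interior J \<inter> space M) \<union> (frontier J \<inter> space M))"
    by (intro finite_measure_mono sets.Un meas) (auto simp: frontier_def)
  also have "\<dots> \<le> measure M (interior J \<inter> space M) + measure M (frontier J \<inter> space M)"
    by (intro measure_Un_le meas)
  finally have cl: "measure M (closure J \<inter> space M) \<le> measure M (interior J \<inter> space M)"
    using J(2) by simp
  have "measure M (interior J \<inter> space M) \<le> ?m" "?m \<le> measure M (closure J \<inter> space M)"
    using interior_subset[of J] closure_subset[of J] by (auto intro!: finite_measure_mono)
  hence int: "measure M (interior J \<inter> space M) = ?m" and cl: "measure M (closure J \<inter> space M) = ?m"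
    using cl by linarith+
  have "- closure J \<inter> space M = space M - (closure J \<inter> space M)"
    by auto
  hence compl: "measure M (- closure J \<inter> space M) = 1 - ?m"
    using cl meas(3) by (simp only: prob_compl)
  show "(\<lambda>N. real (card {n. n < N \<and> (cf_map ^^ n) x \<in> J}) / real N) \<longlonglongrightarrow> ?m"
  proof (rule tendstoI)
    fix e :: real assume e: "e > 0"
    have 1: "eventually (\<lambda>N. ?m - e < real (card {n. n < N \<and> (cf_map ^^ n) x \<in> interior J}) / real N) sequentially"
      using liminf_orbit_open[OF M x freq open_interior e, of J] int by simp
    have 2: "eventually (\<lambda>N. 1 - ?m - e < real (card {n. n < N \<and> (cf_map ^^ n) x \<in> - closure J}) / real N) sequentially"
      using liminf_orbit_open[OF M x freq _ e, of "- closure J"] compl by (simp add: open_Compl)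
    show "eventually (\<lambda>N. dist (real (card {n. n < N \<and> (cf_map ^^ n) x \<in> J}) / real N) ?m < e) sequentially"
      using 1 2 eventually_gt_at_top[of 0]
    proof eventually_elim
      case (elim N)
      let ?c = "\<lambda>A. card {n. n < N \<and> (cf_map ^^ n) x \<in> A}"
      have "?c (interior J) \<le> ?c J"
        using interior_subset[of J] by (intro card_mono) auto
      hence lower: "real (?c (interior J)) / real N \<le> real (?c J) / real N"
        by (intro divide_right_mono) auto
      have "?c J + ?c (- closure J) = card ({n. n < N \<and> (cf_map ^^ n) x \<in> J} \<union> {n. n < N \<and> (cf_map ^^ n) x \<in> - closure J})"
        using closure_subset[of J] by (intro card_Un_disjoint[symmetric]) auto
      also have "\<dots> \<le> card {..<N}"
        by (intro card_mono) auto
      finally have "real (?c J) + real (?c (- closure J)) \<le> real N"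
        by simp
      hence "(real (?c J) + real (?c (- closure J))) / real N \<le> 1"
        using elim by simp
      hence "real (?c J) / real N + real (?c (- closure J)) / real N \<le> 1"
        by (simp add: add_divide_distrib)
      thus ?case
        using elim lower by (simp add: dist_real_def abs_less_iff)
    qed
  qed
qed

text \<open>For positive digits the cylinder comes from an interval with null frontier; a word
  containing 0 never occurs and has an empty cylinder.\<close>

lemma cf_generates_imp_word_freq:
  assumes M: "sets M = sets (restrict_space borel unit_irrationals)"
    and x: "x \<in> unit_irrationals" and gen: "cf_generates x M"
  shows "word_freq (cf_digits x) w \<longlonglongrightarrow> measure M (cylinder w)"
proof (cases "\<forall>d\<in>set w. d > 0")
  case True
  then obtain a b where ab: "cf_interval w = {a..b}" "0 \<le> a" "a \<le> b" "b \<le> 1" "a \<in> \<rat>" "b \<in> \<rat>"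
    using cf_interval_eq by blast
  note space = space_unit_irrationals[OF M]
  have "frontier {a..b} \<subseteq> {a, b}"
    using ab(3) by (auto simp: frontier_def closure_closed)
  hence "frontier {a..b} \<inter> space M = {}"
    using ab unit_irrationalsD(3) space by blast
  hence "(\<lambda>N. real (card {n. n < N \<and> (cf_map ^^ n) x \<in> {a..b}}) / real N)
      \<longlonglongrightarrow> measure M ({a..b} \<inter> space M)"
    using gen[unfolded cf_generates_def, rule_format, of "{a..b}"] ab by (simp add: is_interval_cc)
  moreover have "(cf_map ^^ n) x \<in> {a..b} \<longleftrightarrow> occurs (cf_digits x) w n" for n
    using funpow_in_cylinder_iff[OF x, of n w] cf_map_funpow_in[OF x, of n] cylinder_eq_interval[OF True] ab(1)
    by auto
  ultimately show ?thesis
    using cylinder_eq_interval[OF True] ab(1) space by (simp add: word_freq_def[abs_def])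
next
  case False
  then obtain i where "i < length w" "w ! i = 0"
    by (auto simp: in_set_conv_nth)
  hence "\<not> occurs (cf_digits y) w n" if "y \<in> unit_irrationals" for y n
    using cf_digit_pos[OF that] by (auto simp: occurs_def) (metis less_not_refl)
  moreover from this have "cylinder w = {}"
    by (auto simp: cylinder_def)
  ultimately show ?thesis
    using x by (simp add: word_freq_def[abs_def])
qed

section \<open>Greedy sampling\<close>

lemma half_sums: "(\<lambda>j. (1 / 2) ^ Suc j :: real) sums 1"
  by (rule power_half_series)

lemma summable_half_bounded:
  fixes f :: "nat \<Rightarrow> real"
  assumes "\<And>j. \<bar>f j\<bar> \<le> B"
  shows "summable (\<lambda>j. (1 / 2) ^ Suc j * f j)"
proof (rule summable_comparison_test)
  show "summable (\<lambda>j. (1 / 2) ^ Suc j * B)"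
    by (intro summable_mult2 sums_summable[OF half_sums])
  have "norm ((1 / 2) ^ Suc j * f j) \<le> (1 / 2) ^ Suc j * B" for j
    using assms[of j] by (simp add: abs_mult)
  thus "\<exists>N. \<forall>n\<ge>N. norm ((1 / 2) ^ Suc n * f n) \<le> (1 / 2) ^ Suc n * B"
    by blast
qed

lemma suminf_half_le:
  fixes f :: "nat \<Rightarrow> real"
  assumes "\<And>j. \<bar>f j\<bar> \<le> B"
  shows "(\<Sum>j. (1 / 2) ^ Suc j * f j) \<le> B"
proof -
  have "f j \<le> B" for j
    using assms[of j] by linarith
  hence "(\<Sum>j. (1 / 2) ^ Suc j * f j) \<le> (\<Sum>j. (1 / 2) ^ Suc j * B)"
    by (intro suminf_le summable_half_bounded[OF assms] summable_mult2 sums_summable[OF half_sums]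
        mult_left_mono) auto
  also have "\<dots> = B"
    using sums_unique[OF sums_mult2[OF half_sums, of B]] by simp
  finally show ?thesis .
qed

text \<open>The weighted inner product of \<open>S\<close> with the random vector has mean zero, so
  it is not positive everywhere. Boundedness and the geometric weights justify exchanging sum and
  expectation.\<close>

lemma (in prob_space) exists_descent:
  fixes a :: "nat \<Rightarrow> 'a \<Rightarrow> real"
  assumes meas [measurable]: "\<And>j. a j \<in> borel_measurable M"
    and bound: "\<And>j x. x \<in> space M \<Longrightarrow> \<bar>a j x\<bar> \<le> L"
    and mean: "\<And>j. expectation (a j) = 0"
    and S: "\<And>j. \<bar>S j\<bar> \<le> B"
  shows "\<exists>x\<in>space M. (\<Sum>j. (1 / 2) ^ Suc j * (S j * a j x)) \<le> 0"
proof (rule ccontr)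
  assume "\<not> ?thesis"
  hence pos: "(\<Sum>j. (1 / 2) ^ Suc j * (S j * a j x)) > 0" if "x \<in> space M" for x
    using that by force
  let ?h = "\<lambda>j x. (1 / 2) ^ Suc j * (S j * a j x)"
  obtain x0 where "x0 \<in> space M"
    using not_empty by blast
  hence "L \<ge> 0"
    using bound[of x0 0] by linarith
  have Sa: "\<bar>S j * a j x\<bar> \<le> B * L" if "x \<in> space M" for j x
    using S[of j] bound[OF that, of j] by (simp add: abs_mult mult_mono')
  have norm_h: "norm (?h j x) = (1 / 2) ^ Suc j * \<bar>S j * a j x\<bar>" for j x
    by (simp add: abs_mult)
  have h_le: "norm (?h j x) \<le> (1 / 2) ^ Suc j * (B * L)" if "x \<in> space M" for j x
    unfolding norm_h using Sa[OF that] by (intro mult_left_mono) auto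
  have int: "integrable M (?h j)" for j
    using h_le by (intro integrable_const_bound[of _ "(1 / 2) ^ Suc j * (B * L)"] AE_I2) auto
  have sum1: "AE x in M. summable (\<lambda>j. norm (?h j x))"
    unfolding norm_h using Sa by (intro AE_I2 summable_half_bounded) (auto simp: abs_mult)
  have sum2: "summable (\<lambda>j. \<integral>x. norm (?h j x) \<partial>M)"
  proof (rule summable_comparison_test)
    show "summable (\<lambda>j. (1 / 2) ^ Suc j * (B * L))"
      by (intro summable_mult2 sums_summable[OF half_sums])
    have "norm (\<integral>x. norm (?h j x) \<partial>M) \<le> (1 / 2) ^ Suc j * (B * L)" for j
    proof -
      have "(\<integral>x. norm (?h j x) \<partial>M) \<le> (1 / 2) ^ Suc j * (B * L)"
        using h_le by (intro integral_le_const[OF integrable_norm[OF int]] AE_I2)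
      moreover have "0 \<le> (\<integral>x. norm (?h j x) \<partial>M)"
        by (intro Bochner_Integration.integral_nonneg) auto
      ultimately show ?thesis
        by simp
    qed
    thus "\<exists>N. \<forall>n\<ge>N. norm (\<integral>x. norm (?h n x) \<partial>M) \<le> (1 / 2) ^ Suc n * (B * L)"
      by blast
  qed
  have "expectation (\<lambda>x. \<Sum>j. ?h j x) = (\<Sum>j. expectation (?h j))"
    by (rule integral_suminf[OF int sum1 sum2])
  also have "\<dots> = 0"
    using mean by simp
  finally have "expectation (\<lambda>x. \<Sum>j. ?h j x) = 0" .
  moreover have "0 < expectation (\<lambda>x. \<Sum>j. ?h j x)"
    using pos by (intro expectation_greater integrable_suminf[OF int sum1 sum2] AE_I2)
  ultimately show False
    by simp
qed

text \<open>
  Sampling a mean-zero random vector greedily: choose each sample so that it does not point in the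
  direction of the current sum \<open>S\<close> with respect to the inner product with weights \<open>2 powr - (j + 1)\<close>;
  then the squared norm of \<open>S\<close> grows at most by the squared norm of the sample.
\<close>

lemma (in prob_space) greedy_samples:
  fixes a :: "nat \<Rightarrow> nat \<Rightarrow> 'a \<Rightarrow> real"
  assumes meas: "\<And>n j. a n j \<in> borel_measurable M"
    and bound: "\<And>n j x. x \<in> space M \<Longrightarrow> \<bar>a n j x\<bar> \<le> L n"
    and mean: "\<And>n j. expectation (a n j) = 0"
  obtains y where "\<And>n. y n \<in> space M"
    "\<And>n j. (\<Sum>i<n. a i j (y i))\<^sup>2 \<le> 2 ^ Suc j * (\<Sum>i<n. (L i)\<^sup>2)"
proof -
  define \<Phi> :: "(nat \<Rightarrow> real) \<Rightarrow> real" where "\<Phi> = (\<lambda>S. \<Sum>j. (1 / 2) ^ Suc j * (S j)\<^sup>2)"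
  \<comment> \<open>The coordinate bounds keep all series summable; the bound on
    \<open>\<Phi>\<close> is the real invariant.\<close>
  define P where "P = (\<lambda>n S. (\<forall>j. \<bar>S j\<bar> \<le> (\<Sum>i<n. L i)) \<and> \<Phi> S \<le> (\<Sum>i<n. (L i)\<^sup>2))"
  define Q where "Q = (\<lambda>n S S'. \<exists>x\<in>space M. \<forall>j. S' j = S j + a n j x)"
  have sq_bound: "\<bar>(c :: real)\<^sup>2\<bar> \<le> B\<^sup>2" if "\<bar>c\<bar> \<le> B" for c B
    using power_mono[OF that, of 2] by simp
  have "\<exists>S. \<forall>n. P n (S n) \<and> Q n (S n) (S (Suc n))"
  proof (rule dependent_nat_choice)
    show "\<exists>S. P 0 S"
      by (rule exI[of _ "\<lambda>_. 0"]) (simp add: P_def \<Phi>_def)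
  next
    fix S n assume "P n S"
    hence S: "\<bar>S j\<bar> \<le> (\<Sum>i<n. L i)" "\<Phi> S \<le> (\<Sum>i<n. (L i)\<^sup>2)" for j
      by (auto simp: P_def)
    obtain x where x: "x \<in> space M" "(\<Sum>j. (1 / 2) ^ Suc j * (S j * a n j x)) \<le> 0"
      using exists_descent[of "a n" "L n" S, OF meas bound mean S(1)] by blast
    let ?a = "\<lambda>j. a n j x"
    note a = bound[OF x(1), of n]
    have "L n \<ge> 0"
      using a[of 0] by linarith
    have Sa: "\<bar>S j * ?a j\<bar> \<le> (\<Sum>i<n. L i) * L n" for j
      using S(1)[of j] a[of j] by (simp add: abs_mult mult_mono')
    note sums = summable_half_bounded[OF sq_bound[OF S(1)]] summable_half_bounded[OF Sa]
      summable_half_bounded[OF sq_bound[OF a]]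
    \<comment> \<open>Expanding the square: the cross term is at most 0 by the choice of
      \<open>x\<close>, so \<open>\<Phi>\<close> grows by at most \<open>(L n)^2\<close>.\<close>
    have "\<Phi> (\<lambda>j. S j + ?a j) = (\<Sum>j. (1 / 2) ^ Suc j * (S j)\<^sup>2 +
            2 * ((1 / 2) ^ Suc j * (S j * ?a j)) + (1 / 2) ^ Suc j * (?a j)\<^sup>2)"
      unfolding \<Phi>_def by (intro arg_cong[of _ _ suminf] ext) (simp add: power2_eq_square algebra_simps)
    also have "\<dots> = \<Phi> S + 2 * (\<Sum>j. (1 / 2) ^ Suc j * (S j * ?a j)) + (\<Sum>j. (1 / 2) ^ Suc j * (?a j)\<^sup>2)"
      unfolding \<Phi>_def by (simp only: suminf_add suminf_mult summable_add summable_mult sums flip: suminf_add suminf_mult)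
    also have "\<dots> \<le> (\<Sum>i<Suc n. (L i)\<^sup>2)"
      using S(2) x(2) suminf_half_le[of "\<lambda>j. (?a j)\<^sup>2", OF sq_bound[OF a]] by simp
    finally have "\<Phi> (\<lambda>j. S j + ?a j) \<le> (\<Sum>i<Suc n. (L i)\<^sup>2)" .
    moreover have "\<bar>S j + ?a j\<bar> \<le> (\<Sum>i<Suc n. L i)" for j
      using S(1)[of j] a[of j] by simp
    ultimately have "P (Suc n) (\<lambda>j. S j + ?a j)"
      by (simp add: P_def)
    moreover have "Q n S (\<lambda>j. S j + ?a j)"
      using x(1) by (auto simp: Q_def)
    ultimately show "\<exists>S'. P (Suc n) S' \<and> Q n S S'"
      by blast
  qed
  then obtain S where S: "\<And>n. P n (S n)" "\<And>n. Q n (S n) (S (Suc n))"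
    by blast
  from S(2) have "\<forall>n. \<exists>x. x \<in> space M \<and> (\<forall>j. S (Suc n) j = S n j + a n j x)"
    unfolding Q_def by blast
  then obtain y where y: "\<And>n. y n \<in> space M" "\<And>n j. S (Suc n) j = S n j + a n j (y n)"
    by metis
  have S_sum: "S n j = (\<Sum>i<n. a i j (y i))" for n j
  proof (induction n)
    case 0
    show ?case
      using S(1)[of 0] by (simp add: P_def)
  qed (simp add: y(2))
  show ?thesis
  proof (rule that[OF y(1)])
    fix n j
    have "\<bar>S n j\<bar> \<le> (\<Sum>i<n. L i)" for j
      using S(1)[of n] by (simp add: P_def)
    note summable = summable_half_bounded[OF sq_bound[OF this]]
    \<comment> \<open>One coordinate is bounded by the whole sum, at the price of its inverse weight
      \<open>2 ^ Suc j\<close>.\<close>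
    have "(1 / 2) ^ Suc j * (S n j)\<^sup>2 = (\<Sum>i\<in>{j}. (1 / 2) ^ Suc i * (S n i)\<^sup>2)"
      by simp
    also have "\<dots> \<le> \<Phi> (S n)"
      unfolding \<Phi>_def by (intro sum_le_suminf summable) auto
    also have "\<dots> \<le> (\<Sum>i<n. (L i)\<^sup>2)"
      using S(1)[of n] by (simp add: P_def)
    finally show "(\<Sum>i<n. a i j (y i))\<^sup>2 \<le> 2 ^ Suc j * (\<Sum>i<n. (L i)\<^sup>2)"
      by (simp add: S_sum power_divide field_simps)
  qed
qed

section \<open>Generic points exist\<close>

text \<open>The preimage of \<open>cylinder w\<close> in \<open>unit_irrationals\<close> under the
  \<open>m\<close>th iterate of \<open>cf_map\<close>.\<close>

definition cylinder_at :: "nat list \<Rightarrow> nat \<Rightarrow> real set" where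
  "cylinder_at w m = {x \<in> unit_irrationals. occurs (cf_digits x) w m}"

lemma cylinder_at_0: "cylinder_at w 0 = cylinder w"
  by (simp add: cylinder_at_def cylinder_def)

lemma cylinder_at_sets:
  assumes "sets M = sets (restrict_space borel unit_irrationals)"
  shows "cylinder_at w m \<in> sets M"
  unfolding cylinder_at_def
  by (intro openin_sets[OF assms] openin_digit_prefix[where k = "m + length w"])
     (auto simp: occurs_def)

lemma measure_cylinder_at:
  assumes M: "sets M = sets (restrict_space borel unit_irrationals)" and inv: "cf_invariant M"
  shows "measure M (cylinder_at w m) = measure M (cylinder w)"
proof (induction m)
  case 0
  show ?case
    by (simp add: cylinder_at_0)
next
  case (Suc m)
  have "occurs (cf_digits (cf_map x)) w m \<longleftrightarrow> occurs (cf_digits x) w (Suc m)" for x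
    unfolding occurs_def cf_digits_cf_map by simp
  hence "cf_map -` cylinder_at w m \<inter> space M = cylinder_at w (Suc m)"
    using cf_map_in_unit_irrationals by (auto simp: cylinder_at_def space_unit_irrationals[OF M])
  hence "measure M (cylinder_at w (Suc m)) = measure M (cylinder_at w m)"
    using inv cylinder_at_sets[OF M, of w m] by (simp add: cf_invariant_def measure_def)
  thus ?case
    using Suc by simp
qed

text \<open>Concatenation of the blocks consisting of the first \<open>i + 1\<close> terms of \<open>u i\<close>, for \<open>i = 0, 1, 2, \<dots>\<close>;
  the \<open>i\<close>th block starts at position \<^term>\<open>triangle i\<close>.\<close>

definition concat_blocks :: "(nat \<Rightarrow> nat \<Rightarrow> 'a) \<Rightarrow> nat \<Rightarrow> 'a" where
  "concat_blocks u n = (case prod_decode n of (m, k) \<Rightarrow> u (m + k) m)"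

text \<open>\<open>prod_decode\<close> runs through the antidiagonals \<open>m + k = i\<close> one
  after the other, and the \<open>i\<close>th has \<open>i + 1\<close> elements.\<close>

lemma concat_blocks_triangle:
  assumes "m \<le> i"
  shows "concat_blocks u (triangle i + m) = u i m"
  using assms by (simp add: concat_blocks_def prod_decode_triangle_add prod_decode_aux.simps)

lemma triangle_decomp:
  obtains i m where "N = triangle i + m" "m \<le> i"
proof -
  obtain m k where "prod_decode N = (m, k)"
    by fastforce
  hence "N = triangle (m + k) + m"
    using prod_decode_inverse[of N] by (simp add: prod_encode_def)
  thus ?thesis
    using that by force
qed

text \<open>At most \<open>sqrt (2 * N)\<close> complete blocks fit below position
  \<open>N\<close>.\<close>

lemma square_le_triangle: "n\<^sup>2 \<le> 2 * triangle n"
  by (induction n) (auto simp: power2_eq_square)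

lemma card_less_add:
  "card {p. p < a + b \<and> P p} = card {p. p < a \<and> P p} + card {m. m < b \<and> P (a + m :: nat)}"
proof -
  have "{p. p < a + b \<and> P p} = {p. p < a \<and> P p} \<union> (\<lambda>m. a + m) ` {m. m < b \<and> P (a + m)}"
  proof (intro equalityI subsetI)
    fix p assume p: "p \<in> {p. p < a + b \<and> P p}"
    show "p \<in> {p. p < a \<and> P p} \<union> (\<lambda>m. a + m) ` {m. m < b \<and> P (a + m)}"
    proof (cases "p < a")
      case False
      hence "p = a + (p - a)"
        by simp
      with p False show ?thesis
        by (intro UnI2 image_eqI[of _ _ "p - a"]) auto
    qed (use p in auto)
  qed auto
  hence "card {p. p < a + b \<and> P p} = card {p. p < a \<and> P p} + card ((\<lambda>m. a + m) ` {m. m < b \<and> P (a + m)})"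
    by (simp only:) (intro card_Un_disjoint, auto)
  thus ?thesis
    by (simp add: card_image)
qed

text \<open>Within a block, occurrences in the concatenation and in \<open>u i\<close> can differ
  only at the last \<open>length w\<close> starting positions, where the window may cross the end of
  the block.\<close>

lemma card_occurs_concat_blocks:
  "\<bar>real (card {p. p < triangle n \<and> occurs (concat_blocks u) w p}) -
     (\<Sum>i<n. real (card {m. m < Suc i \<and> occurs (u i) w m}))\<bar> \<le> real (length w * n)"
proof (induction n)
  case 0
  show ?case
    by simp
next
  case (Suc n)
  let ?s = "concat_blocks u"
  let ?E = "{Suc n - length w..<Suc n}"
  have occ: "occurs ?s w (triangle n + m) \<longleftrightarrow> occurs (u n) w m" if "m < Suc n" "m \<notin> ?E" for m
  proof -
    have "?s (triangle n + m + k) = u n (m + k)" if "k < length w" for k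
      using concat_blocks_triangle[of "m + k" n u] that \<open>m < Suc n\<close> \<open>m \<notin> ?E\<close> by (simp add: add.assoc)
    thus ?thesis
      by (simp add: occurs_def)
  qed
  have "\<bar>real (card {m. m < Suc n \<and> occurs ?s w (triangle n + m)}) -
         real (card {m. m < Suc n \<and> occurs (u n) w m})\<bar> \<le> real (card ?E)"
  proof -
    have "card {m. m < Suc n \<and> occurs ?s w (triangle n + m)} \<le> card {m. m < Suc n \<and> occurs (u n) w m} + card ?E"
      by (intro card_filter_le) (use occ in blast)+
    moreover have "card {m. m < Suc n \<and> occurs (u n) w m} \<le> card {m. m < Suc n \<and> occurs ?s w (triangle n + m)} + card ?E"
      by (intro card_filter_le) (use occ in blast)+
    ultimately show ?thesis
      by linarith
  qed
  also have "real (card ?E) \<le> real (length w)"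
    by simp
  finally show ?case
    using Suc.IH card_less_add[of "triangle n" "Suc n" "occurs ?s w"] by (simp add: algebra_simps)
qed

lemma sum_Suc_triangle: "(\<Sum>i<n. Suc i) = triangle n"
  by (induction n) auto

lemma generic_digits:
  assumes M: "sets M = sets (restrict_space borel unit_irrationals)" "prob_space M"
    and inv: "cf_invariant M"
  obtains s where "\<And>n. s n > 0" "\<And>w. word_freq s w \<longlonglongrightarrow> measure M (cylinder w)"
proof -
  interpret prob_space M by fact
  note space = space_unit_irrationals[OF M(1)]
  note [measurable] = cylinder_at_sets[OF M(1)]
  define \<mu> where "\<mu> = (\<lambda>w. measure M (cylinder w))"
  have \<mu>: "0 \<le> \<mu> w" "\<mu> w \<le> 1" for w
    by (auto simp: \<mu>_def)
  \<comment> \<open>The centred number of occurrences of \<open>w\<close> starting in the first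
    \<open>Suc i\<close> positions; its mean is 0 by invariance.\<close>
  define b where "b = (\<lambda>i w x. (\<Sum>m<Suc i. indicator (cylinder_at w m) x) - real (Suc i) * \<mu> w)"
  have bound: "\<bar>b i w x\<bar> \<le> real (Suc i)" for i w x
  proof -
    have "(\<Sum>m<Suc i. indicator (cylinder_at w m) x) \<le> (\<Sum>m<Suc i. 1 :: real)"
      by (intro sum_mono) (auto simp: indicator_def)
    moreover have "0 \<le> (\<Sum>m<Suc i. indicator (cylinder_at w m) x :: real)"
      by (intro sum_nonneg) auto
    moreover have "0 \<le> real (Suc i) * \<mu> w" "real (Suc i) * \<mu> w \<le> real (Suc i) * 1"
      using \<mu> by (auto intro!: mult_left_mono simp del: of_nat_Suc)
    ultimately show ?thesis
      unfolding b_def by (simp only: sum_constant card_lessThan mult_1_right)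
  qed
  have mean: "expectation (b i w) = 0" for i w
  proof -
    have int: "integrable M (indicator (cylinder_at w m) :: real \<Rightarrow> real)" for m
      using cylinder_at_sets[OF M(1)] by (simp add: less_top[symmetric])
    have "expectation (b i w) = expectation (\<lambda>x. \<Sum>m<Suc i. indicator (cylinder_at w m) x) -
            expectation (\<lambda>x. real (Suc i) * \<mu> w)"
      unfolding b_def
      by (intro Bochner_Integration.integral_diff Bochner_Integration.integrable_sum int integrable_const)
    also have "expectation (\<lambda>x. \<Sum>m<Suc i. indicator (cylinder_at w m) x) =
            (\<Sum>m<Suc i. expectation (indicator (cylinder_at w m)) :: real)"
      by (intro Bochner_Integration.integral_sum int)
    also have "\<dots> = (\<Sum>m<Suc i. \<mu> w)"
      using sets.Int_space_eq2[OF cylinder_at_sets[OF M(1)]]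
      by (intro sum.cong) (simp_all add: measure_cylinder_at[OF M(1) inv] \<mu>_def)
    finally show ?thesis
      by (simp add: prob_space)
  qed
  have meas: "(\<lambda>x. b i w x) \<in> borel_measurable M" for i w
    unfolding b_def by measurable
  \<comment> \<open>Enumerating the words by \<open>from_nat\<close> lets a single sequence of
    samples control all words at once.\<close>
  obtain y where y: "\<And>n. y n \<in> space M"
    "\<And>n j. (\<Sum>i<n. b i (from_nat j) (y i))\<^sup>2 \<le> 2 ^ Suc j * (\<Sum>i<n. (real (Suc i))\<^sup>2)"
    by (rule greedy_samples[of "\<lambda>i j. b i (from_nat j)" "\<lambda>i. real (Suc i)"])
       (use meas mean bound in auto)
  define s where "s = concat_blocks (\<lambda>i. cf_digits (y i))"
  have "s n > 0" for n
    using cf_digit_pos y(1) space by (auto simp: s_def concat_blocks_def split: prod.splits)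
  moreover have "word_freq s w \<longlonglongrightarrow> \<mu> w" for w
  proof -
    define l where "l = real (length w)"
    define C where "C = (2 :: real) ^ Suc (to_nat w)"
    let ?cnt = "\<lambda>N. real (card {p. p < N \<and> occurs s w p})"
    have C: "C \<ge> 0"
      by (simp add: C_def)
    \<comment> \<open>The sampling error after \<open>n\<close> blocks has order \<open>n\<close> to
      the power 3/2, while their total length has order \<open>n^2\<close>.\<close>
    have greedy: "\<bar>\<Sum>i<n. b i w (y i)\<bar> \<le> sqrt C * sqrt (real n ^ 3)" for n
    proof -
      have "(\<Sum>i<n. (real (Suc i))\<^sup>2) \<le> (\<Sum>i<n. (real n)\<^sup>2)"
        by (intro sum_mono power_mono) auto
      also have "\<dots> = real n ^ 3"
        by (simp add: power2_eq_square power3_eq_cube)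
      finally have "(\<Sum>i<n. b i w (y i))\<^sup>2 \<le> C * real n ^ 3"
        using y(2)[where j1 = "to_nat w" and n1 = n] C mult_left_mono[of _ "real n ^ 3" C] unfolding C_def
        by (simp only: from_nat_to_nat) (meson order_trans)
      hence "\<bar>\<Sum>i<n. b i w (y i)\<bar> \<le> sqrt (C * real n ^ 3)"
        by (metis real_sqrt_abs real_sqrt_le_mono)
      thus ?thesis
        by (simp add: real_sqrt_mult)
    qed
    have card_ind: "real (card {m. m < Suc i \<and> occurs (cf_digits (y i)) w m}) =
        b i w (y i) + real (Suc i) * \<mu> w" for i
    proof -
      have "(\<Sum>m<Suc i. indicator (cylinder_at w m) (y i)) =
            (\<Sum>m<Suc i. if occurs (cf_digits (y i)) w m then 1 else 0 :: real)"
        using y(1)[of i] space by (intro sum.cong) (auto simp: cylinder_at_def indicator_def)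
      also have "\<dots> = real (card {m. m < Suc i \<and> occurs (cf_digits (y i)) w m})"
        by (subst sum.If_cases) (auto simp: Int_def)
      finally show ?thesis
        by (simp only: b_def)
    qed
    have tri: "\<bar>?cnt (triangle n) - \<mu> w * real (triangle n)\<bar> \<le> l * real n + sqrt C * sqrt (real n ^ 3)" for n
    proof -
      have "(\<Sum>i<n. real (card {m. m < Suc i \<and> occurs (cf_digits (y i)) w m})) =
            (\<Sum>i<n. b i w (y i)) + real (\<Sum>i<n. Suc i) * \<mu> w"
        by (simp only: card_ind sum.distrib sum_distrib_right of_nat_sum)
      thus ?thesis
        using card_occurs_concat_blocks[of n "\<lambda>i. cf_digits (y i)" w] greedy[of n]
        unfolding s_def[symmetric] sum_Suc_triangle l_def by (simp add: mult.commute)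
    qed
    \<comment> \<open>Three errors are collected: the block ends, the greedy sampling, and the
      unfinished block, which contributes at most \<open>n\<close>.\<close>
    have err: "\<bar>word_freq s w N - \<mu> w\<bar> \<le> (l + 1) * (sqrt (2 * real N) / real N) +
                 sqrt C * (sqrt (sqrt (2 * real N) ^ 3) / real N)" if N: "N > 0" for N
    proof -
      obtain n m where nm: "N = triangle n + m" "m \<le> n"
        by (rule triangle_decomp)
      let ?r = "sqrt (2 * real N)"
      have "n\<^sup>2 \<le> 2 * N"
        using square_le_triangle[of n] nm by simp
      hence "real (n\<^sup>2) \<le> real (2 * N)"
        by (simp only: of_nat_le_iff)
      hence n: "real n \<le> ?r"
        by (intro real_le_rsqrt) simp
      have "?cnt N = ?cnt (triangle n) + real (card {p. p < m \<and> occurs s w (triangle n + p)})"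
        using card_less_add[of "triangle n" m "occurs s w"] nm by simp
      moreover have "card {p. p < m \<and> occurs s w (triangle n + p)} \<le> card {..<m}"
        by (intro card_mono) auto
      moreover have "0 \<le> \<mu> w * real m" "\<mu> w * real m \<le> 1 * real m"
        using mult_right_mono[OF \<mu>(2), of "real m" w] \<mu>(1)[of w] by auto
      ultimately have "\<bar>?cnt N - \<mu> w * real N\<bar> \<le> l * real n + sqrt C * sqrt (real n ^ 3) + real n"
        using tri[of n] nm by (simp add: algebra_simps)
      also have "\<dots> \<le> l * ?r + sqrt C * sqrt (?r ^ 3) + ?r"
        using n C by (intro add_mono mult_left_mono real_sqrt_le_mono power_mono) (auto simp: l_def)
      finally have *: "\<bar>?cnt N - \<mu> w * real N\<bar> \<le> (l + 1) * ?r + sqrt C * sqrt (?r ^ 3)"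
        by (simp add: algebra_simps)
      have "\<bar>word_freq s w N - \<mu> w\<bar> = \<bar>?cnt N - \<mu> w * real N\<bar> / real N"
        using N by (simp add: word_freq_def field_simps)
      also have "\<dots> \<le> ((l + 1) * ?r + sqrt C * sqrt (?r ^ 3)) / real N"
        using * by (intro divide_right_mono) auto
      finally show ?thesis
        by (simp add: add_divide_distrib)
    qed
    have "(\<lambda>N. sqrt (2 * real N) / real N) \<longlonglongrightarrow> 0" "(\<lambda>N. sqrt (sqrt (2 * real N) ^ 3) / real N) \<longlonglongrightarrow> 0"
      by real_asymp+
    hence "(\<lambda>N. (l + 1) * (sqrt (2 * real N) / real N) +
              sqrt C * (sqrt (sqrt (2 * real N) ^ 3) / real N)) \<longlonglongrightarrow> (l + 1) * 0 + sqrt C * 0"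
      by (intro tendsto_add tendsto_mult tendsto_const)
    hence lim0: "(\<lambda>N. (l + 1) * (sqrt (2 * real N) / real N) +
              sqrt C * (sqrt (sqrt (2 * real N) ^ 3) / real N)) \<longlonglongrightarrow> 0"
      by simp
    have "(\<lambda>N. word_freq s w N - \<mu> w) \<longlonglongrightarrow> 0"
      by (rule Lim_null_comparison[OF _ lim0])
         (use eventually_gt_at_top[of 0] in eventually_elim, use err in simp)
    thus ?thesis
      by (simp only: LIM_zero_iff)
  qed
  ultimately show ?thesis
    unfolding \<mu>_def by (rule that)
qed

section \<open>Completeness\<close>

lemma word_freq_cong:
  assumes "\<And>i. i < N + length w \<Longrightarrow> s i = t i"
  shows "word_freq s w N = word_freq t w N"
proof -
  have "{n. n < N \<and> occurs s w n} = {n. n < N \<and> occurs t w n}"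
    using assms by (auto simp: occurs_def)
  thus ?thesis
    by (simp add: word_freq_def)
qed

text \<open>Finitely many digits determine both frequencies. The arbitrary relation \<open>R\<close>
  covers both the Cauchy criterion and the distance to a given limit.\<close>

lemma openin_word_freq:
  "openin (top_of_set unit_irrationals)
     {x \<in> unit_irrationals. R (word_freq (cf_digits x) w m) (word_freq (cf_digits x) w n)}"
proof (rule openin_digit_prefix[where k = "max m n + length w"])
  fix x y assume "\<And>i. i < max m n + length w \<Longrightarrow> cf_digits x i = cf_digits y i"
  hence "word_freq (cf_digits x) w N = word_freq (cf_digits y) w N" if "N \<le> max m n" for N
    using that by (intro word_freq_cong) auto
  thus "R (word_freq (cf_digits x) w m) (word_freq (cf_digits x) w n) =
        R (word_freq (cf_digits y) w m) (word_freq (cf_digits y) w n)"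
    by simp
qed

lemma openin_Ex:
  assumes "\<And>i. openin X {x \<in> S. P i x}"
  shows "openin X {x \<in> S. \<exists>i. P i x}"
proof -
  have "{x \<in> S. \<exists>i. P i x} = (\<Union>i. {x \<in> S. P i x})"
    by auto
  also have "openin X \<dots>"
    using assms by (intro openin_Union) auto
  finally show ?thesis .
qed

lemma ex_inverse_Suc:
  "(\<exists>e>0. \<forall>N. \<exists>n\<ge>N. e \<le> g n) \<longleftrightarrow> (\<exists>k. \<forall>N. \<exists>n\<ge>N. 1 / real (Suc k) \<le> (g n :: real))"
proof
  assume "\<exists>e>0. \<forall>N. \<exists>n\<ge>N. e \<le> g n"
  then obtain e where e: "e > 0" "\<And>N. \<exists>n\<ge>N. e \<le> g n"
    by blast
  obtain k where "1 / real (Suc k) < e"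
    using nat_approx_posE[OF e(1)] by blast
  thus "\<exists>k. \<forall>N. \<exists>n\<ge>N. 1 / real (Suc k) \<le> g n"
    using e(2) by (meson less_imp_le order_trans)
next
  assume "\<exists>k. \<forall>N. \<exists>n\<ge>N. 1 / real (Suc k) \<le> g n"
  thus "\<exists>e>0. \<forall>N. \<exists>n\<ge>N. e \<le> g n"
    by (metis divide_pos_pos of_nat_0_less_iff zero_less_Suc zero_less_one)
qed

lemma not_tendsto_iff:
  "\<not> f \<longlonglongrightarrow> L \<longleftrightarrow> (\<exists>k. \<forall>N. \<exists>n\<ge>N. 1 / real (Suc k) \<le> \<bar>f n - L\<bar>)" for L :: real
  unfolding LIMSEQ_iff real_norm_def ex_inverse_Suc[symmetric] by (simp add: not_less)

text \<open>The negated Cauchy criterion with countable quantifiers, in the shape that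
  \<open>Sigma0_3I\<close> expects.\<close>

lemma not_convergent_iff:
  "\<not> convergent f \<longleftrightarrow> (\<exists>k. \<forall>N. \<exists>n\<ge>N. \<exists>m\<ge>N. 1 / real (Suc k) \<le> \<bar>f n - f m\<bar>)" for f :: "nat \<Rightarrow> real"
proof
  assume "\<not> convergent f"
  then obtain e where e: "e > 0" "\<And>N. \<exists>m\<ge>N. \<exists>n\<ge>N. e \<le> \<bar>f m - f n\<bar>"
    unfolding Cauchy_convergent_iff[symmetric] Cauchy_iff by (auto simp: not_less)
  obtain k where "1 / real (Suc k) < e"
    using nat_approx_posE[OF e(1)] by blast
  thus "\<exists>k. \<forall>N. \<exists>n\<ge>N. \<exists>m\<ge>N. 1 / real (Suc k) \<le> \<bar>f n - f m\<bar>"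
    using e(2) by (meson less_imp_le order_trans)
next
  assume "\<exists>k. \<forall>N. \<exists>n\<ge>N. \<exists>m\<ge>N. 1 / real (Suc k) \<le> \<bar>f n - f m\<bar>"
  then obtain k where k: "\<And>N. \<exists>n\<ge>N. \<exists>m\<ge>N. 1 / real (Suc k) \<le> \<bar>f n - f m\<bar>"
    by blast
  have "0 < 1 / real (Suc k)"
    by simp
  with k show "\<not> convergent f"
    unfolding Cauchy_convergent_iff[symmetric] Cauchy_iff real_norm_def by (meson not_less)
qed

lemma Sigma0_3_not_convergent:
  "{x \<in> unit_irrationals. \<exists>w. Q w \<and> \<not> convergent (word_freq (cf_digits x) w)}
     \<in> Sigma0 (top_of_set unit_irrationals) 3"
proof (rule Sigma0_3I)
  let ?U = "\<lambda>i N. {x \<in> unit_irrationals. Q (fst i) \<and> (\<exists>n m. n \<ge> N \<and> m \<ge> N \<and>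
    1 / real (Suc (snd i)) \<le> \<bar>word_freq (cf_digits x) (fst i) n - word_freq (cf_digits x) (fst i) m\<bar>)}"
  show "openin (top_of_set unit_irrationals) (?U i N)" for i N
  proof (cases "Q (fst i)")
    case True
    show ?thesis
      unfolding eqTrueI[OF True] simp_thms
      by (intro openin_Ex openin_word_freq[where R = "\<lambda>a b. _ \<and> _ \<and> _ \<le> \<bar>a - b\<bar>"])
  qed simp
  show "{x \<in> unit_irrationals. \<exists>w. Q w \<and> \<not> convergent (word_freq (cf_digits x) w)} =
        (\<Union>i. topspace (top_of_set unit_irrationals) \<inter> (\<Inter>N. ?U i N))"
    unfolding not_convergent_iff by auto blast+
qed

lemma Sigma0_3_not_tendsto:
  "{x \<in> unit_irrationals. \<exists>w. \<not> word_freq (cf_digits x) w \<longlonglongrightarrow> L w}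
     \<in> Sigma0 (top_of_set unit_irrationals) 3"
proof (rule Sigma0_3I)
  let ?U = "\<lambda>i N. {x \<in> unit_irrationals. \<exists>n. n \<ge> N \<and>
    1 / real (Suc (snd i)) \<le> \<bar>word_freq (cf_digits x) (fst i) n - L (fst i)\<bar>}"
  show "openin (top_of_set unit_irrationals) (?U i N)" for i N
    by (intro openin_Ex openin_word_freq[where R = "\<lambda>a b. _ \<and> _ \<le> \<bar>a - L (fst i)\<bar>" and m = n and n = n for n])
  show "{x \<in> unit_irrationals. \<exists>w. \<not> word_freq (cf_digits x) w \<longlonglongrightarrow> L w} =
        (\<Union>i. topspace (top_of_set unit_irrationals) \<inter> (\<Inter>N. ?U i N))"
    unfolding not_tendsto_iff by auto blast+
qed

lemma Sigma0_3_subset: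
  assumes "A \<in> Sigma0 X 3"
  shows "A \<subseteq> topspace X"
  using assms by (auto simp: Sigma0_3_iff Pi0_def)

text \<open>Translates digit positions counted from 1 into positions counted from 0.\<close>

lemma cf_irregular_iff:
  "cf_irregular x \<longleftrightarrow>
     (\<exists>w. (w \<noteq> [] \<and> (\<forall>d\<in>set w. d > 0)) \<and> \<not> convergent (word_freq (cf_digits x) w))"
proof -
  have "real (card {i\<in>{1..N}. map (cf_digit x) [i..<i + length w] = w}) / real N =
        word_freq (cf_digits x) w N" for w N
  proof -
    have "occurs (cf_digits x) w n \<longleftrightarrow> map (cf_digit x) [Suc n..<Suc n + length w] = w" for n
      unfolding occurs_iff_map by (simp flip: map_Suc_upt add: comp_def del: upt_Suc)
    hence "{i\<in>{1..N}. map (cf_digit x) [i..<i + length w] = w} = Suc ` {n. n < N \<and> occurs (cf_digits x) w n}"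
      by (auto simp: image_iff Suc_le_eq gr0_conv_Suc)
    thus ?thesis
      by (simp add: word_freq_def card_image)
  qed
  thus ?thesis
    unfolding cf_irregular_def by (simp add: conj_assoc)
qed

text \<open>Lower bound for both halves of the theorem: \<open>P\<close> contains all points with
  frequencies \<open>L\<close>, and at its points the frequency of \<open>c\<close> converges. The
  reduction maps \<open>\<beta>\<close> to the point with digits
  \<open>perturb s c \<beta>\<close>.\<close>

lemma frequency_set_not_Sigma0_3:
  assumes s: "\<And>n. s n > 0" "\<And>w. word_freq s w \<longlonglongrightarrow> L w"
    and c: "c > 0" "L [c] \<noteq> 1"
    and P: "\<And>x. x \<in> unit_irrationals \<Longrightarrow> (\<And>w. word_freq (cf_digits x) w \<longlonglongrightarrow> L w) \<Longrightarrow> x \<in> P"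
      "\<And>x. x \<in> P \<Longrightarrow> convergent (word_freq (cf_digits x) [c])"
  shows "P \<notin> Sigma0 (top_of_set unit_irrationals) 3"
proof -
  have "\<exists>x. x \<in> unit_irrationals \<and> cf_digits x = perturb s c \<beta>" for \<beta>
  proof -
    have "perturb s c \<beta> n > 0" for n
      using s(1) c(1) by (simp add: perturb_def)
    thus ?thesis
      using cf_digits_surj by metis
  qed
  then obtain f where f: "\<And>\<beta>. f \<beta> \<in> unit_irrationals" "\<And>\<beta>. cf_digits (f \<beta>) = perturb s c \<beta>"
    by metis
  show ?thesis
  proof (rule reduction_not_Sigma0_3)
    fix U \<beta> assume "openin (top_of_set unit_irrationals) U" "f \<beta> \<in> U"
    then obtain n where n: "\<And>y. y \<in> unit_irrationals \<Longrightarrow> (\<And>i. i < n \<Longrightarrow> cf_digits y i = cf_digits (f \<beta>) i) \<Longrightarrow> y \<in> U"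
      using openin_cf_digits[of U "f \<beta>"] by metis
    have "f \<beta>' \<in> U" if "\<forall>i<n. \<beta>' i = \<beta> i" for \<beta>'
      using that runs_cong[of n \<beta>' \<beta>] by (intro n f(1)) (simp add: fun_cong[OF f(2)] perturb_def)
    thus "\<exists>n. \<forall>\<beta>'. (\<forall>i<n. \<beta>' i = \<beta> i) \<longrightarrow> f \<beta>' \<in> U"
      by blast
  next
    fix \<beta>
    show "f \<beta> \<in> P \<longleftrightarrow> filterlim \<beta> at_top sequentially"
    proof
      assume "f \<beta> \<in> P"
      thus "filterlim \<beta> at_top sequentially"
        using P(2)[of "f \<beta>"] perturb_not_convergent[OF _ s(2) c(2), of \<beta>] by (auto simp: f(2))
    next
      assume "filterlim \<beta> at_top sequentially"
      thus "f \<beta> \<in> P"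
        using perturb_word_freq[OF _ s(2)] by (intro P(1) f(1)) (simp add: f(2))
    qed
  qed
qed

lemma cf_generates_iff:
  assumes "sets M = sets (restrict_space borel unit_irrationals)" "prob_space M" "x \<in> unit_irrationals"
  shows "cf_generates x M \<longleftrightarrow> (\<forall>w. word_freq (cf_digits x) w \<longlonglongrightarrow> measure M (cylinder w))"
  using cf_generatesI[OF assms] cf_generates_imp_word_freq[OF assms(1,3)] by blast

lemma Pi0_complete_cf_generates:
  assumes M: "sets M = sets (restrict_space borel unit_irrationals)" "prob_space M"
    and inv: "cf_invariant M"
  shows "Pi0_complete (top_of_set unit_irrationals) 3 {x \<in> unit_irrationals. cf_generates x M}"
proof -
  let ?G = "{x \<in> unit_irrationals. cf_generates x M}"
  have "?G = topspace (top_of_set unit_irrationals) -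
      {x \<in> unit_irrationals. \<exists>w. \<not> word_freq (cf_digits x) w \<longlonglongrightarrow> measure M (cylinder w)}"
    using cf_generates_iff[OF M] by auto
  hence "?G \<in> Pi0 (top_of_set unit_irrationals) 3"
    unfolding Pi0_def by (rule image_eqI[OF _ Sigma0_3_not_tendsto])
  moreover have "?G \<notin> Sigma0 (top_of_set unit_irrationals) 3"
  proof -
    interpret prob_space M by fact
    obtain s where s: "\<And>n. s n > 0" "\<And>w. word_freq s w \<longlonglongrightarrow> measure M (cylinder w)"
      using generic_digits[OF M inv] by blast
    \<comment> \<open>The cylinders of the digits 1 and 2 are disjoint, so at least one of them does
      not have full measure.\<close>
    have "measure M (cylinder [1]) + measure M (cylinder [2]) = measure M (cylinder [1] \<union> cylinder [2])"
      using cylinder_sets[OF M(1)] cylinder_disjoint[of "[1]" "[2]"]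
      by (intro finite_measure_Union[symmetric]) auto
    also have "\<dots> \<le> 1"
      by simp
    finally have "measure M (cylinder [1]) \<noteq> 1 \<or> measure M (cylinder [2]) \<noteq> 1"
      by linarith
    then obtain c where c: "c > 0" "measure M (cylinder [c]) \<noteq> 1"
      using zero_less_one zero_less_numeral by blast
    show ?thesis
    proof (rule frequency_set_not_Sigma0_3[OF s c])
      show "x \<in> ?G" if "x \<in> unit_irrationals" "\<And>w. word_freq (cf_digits x) w \<longlonglongrightarrow> measure M (cylinder w)" for x
        using that cf_generatesI[OF M] by blast
      show "convergent (word_freq (cf_digits x) [c])" if "x \<in> ?G" for x
        using that cf_generates_imp_word_freq[OF M(1)] by (auto simp: convergent_def)
    qed
  qed
  ultimately show ?thesis
    by (simp add: Pi0_complete_def)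
qed

lemma word_freq_const:
  "word_freq (\<lambda>_. d) w \<longlonglongrightarrow> (if \<forall>i<length w. w ! i = d then 1 else 0)"
proof (cases "\<forall>i<length w. w ! i = d")
  case True
  hence "word_freq (\<lambda>_. d) w N = 1" if "N > 0" for N
    using that by (simp add: word_freq_def occurs_def)
  hence "eventually (\<lambda>N. word_freq (\<lambda>_. d) w N = 1) sequentially"
    using eventually_gt_at_top[of 0] by (rule eventually_mono[rotated])
  thus ?thesis
    using True by (simp add: tendsto_eventually)
next
  case False
  hence "\<not> occurs (\<lambda>_. d) w n" for n
    by (auto simp: occurs_def)
  thus ?thesis
    unfolding if_not_P[OF False] by (simp add: word_freq_def[abs_def])
qed

lemma Sigma0_complete_cf_irregular:
  "Sigma0_complete (top_of_set unit_irrationals) 3 {x \<in> unit_irrationals. cf_irregular x}"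
proof -
  let ?X = "top_of_set unit_irrationals" and ?I = "{x \<in> unit_irrationals. cf_irregular x}"
  have "?I \<in> Sigma0 ?X 3"
    unfolding cf_irregular_iff by (rule Sigma0_3_not_convergent)
  moreover have "?I \<notin> Pi0 ?X 3"
  proof
    assume "?I \<in> Pi0 ?X 3"
    then obtain B where B: "B \<in> Sigma0 ?X 3" "?I = unit_irrationals - B"
      by (auto simp: Pi0_def)
    hence "B = {x \<in> unit_irrationals. \<not> cf_irregular x}"
      using Sigma0_3_subset[OF B(1)] by auto
    \<comment> \<open>The sequence that is constantly 1 is overwritten by the digit 2, whose
      frequency in it is 0.\<close>
    moreover have "{x \<in> unit_irrationals. \<not> cf_irregular x} \<notin> Sigma0 ?X 3"
    proof (rule frequency_set_not_Sigma0_3)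
      show "word_freq (\<lambda>_. 1) w \<longlonglongrightarrow> (if \<forall>i<length w. w ! i = 1 then 1 else 0)" for w
        by (rule word_freq_const)
      show "x \<in> {x \<in> unit_irrationals. \<not> cf_irregular x}"
        if "x \<in> unit_irrationals" "\<And>w. word_freq (cf_digits x) w \<longlonglongrightarrow> (if \<forall>i<length w. w ! i = 1 then 1 else 0)" for x
        using that unfolding cf_irregular_iff by (auto simp: convergent_def)
      show "convergent (word_freq (cf_digits x) [2])" if "x \<in> {x \<in> unit_irrationals. \<not> cf_irregular x}" for x
      proof -
        have "[2 :: nat] \<noteq> [] \<and> (\<forall>d\<in>set [2 :: nat]. d > 0)"
          by simp
        thus ?thesis
          using that unfolding cf_irregular_iff by blast
      qed
    qed auto
    ultimately show False
      using B(1) by simp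
  qed
  ultimately show ?thesis
    by (simp add: Sigma0_complete_def)
qed

theorem theorem17:
  shows "(\<forall>M :: real measure.
            sets M = sets (restrict_space borel unit_irrationals) \<and> prob_space M \<and> cf_invariant M \<longrightarrow>
            Pi0_complete (top_of_set unit_irrationals) 3 {x \<in> unit_irrationals. cf_generates x M}) \<and>
         Sigma0_complete (top_of_set unit_irrationals) 3 {x \<in> unit_irrationals. cf_irregular x}"
  using Pi0_complete_cf_generates Sigma0_complete_cf_irregular by blast

end
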